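(* Let $K$ be an algebraically closed field (of arbitrary characteristic). If $p$ is a prime number, then $\operatorname{str}_K(\det_p)=p$, where $\det_p$ is the determinant of the generic $p\times p$ matrix, viewed as a homogeneous polynomial of degree $p$ in its $p^2$ entries over $K$.
   Context: For a polynomial ring $S=K[x_1,\ldots,x_N]$ and a homogeneous polynomial $f\in S$ of degree $d\ge 2$, the strength $\operatorname{str}_K(f)$ is the smallest integer $r$ for which one can write $f=\sum_{i=1}^r g_ih_i$ with $g_i,h_i\in S$ homogeneous polynomials satisfying $0<\deg g_i,\deg h_i<d$. *)

theory Defs
  imports
    "HOL-Library.Poly_Mapping"
    "HOL-Computational_Algebra.Polynomial"
    "HOL-Computational_Algebra.Primes"
    "Jordan_Normal_Form.Determinant"
begin

text \<open>
  A polynomial is a finitely supported function from exponent vectors to coefficients. The type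
  \<open>'x\<close> only supplies names for variables; the polynomial ring in a given set \<open>X\<close> of variables
  is carved out by \<open>polys_in\<close>.
\<close>

type_synonym ('x, 'k) mpoly = "('x \<Rightarrow>\<^sub>0 nat) \<Rightarrow>\<^sub>0 'k"

definition var :: "'x \<Rightarrow> ('x, 'k::comm_ring_1) mpoly" where
  "var x = Poly_Mapping.single (Poly_Mapping.single x 1) 1"

definition polys_in :: "'x set \<Rightarrow> ('x, 'k::comm_ring_1) mpoly set" where
  "polys_in X = {f. \<forall>m \<in> Poly_Mapping.keys f. Poly_Mapping.keys m \<subseteq> X}"

definition monom_degree :: "('x \<Rightarrow>\<^sub>0 nat) \<Rightarrow> nat" where
  "monom_degree m = (\<Sum>x \<in> Poly_Mapping.keys m. Poly_Mapping.lookup m x)"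

text \<open>The zero polynomial gets total degree 0.\<close>

definition total_degree :: "('x, 'k::comm_ring_1) mpoly \<Rightarrow> nat" where
  "total_degree f = Max (insert 0 (monom_degree ` Poly_Mapping.keys f))"

definition homogeneous :: "('x, 'k::comm_ring_1) mpoly \<Rightarrow> bool" where
  "homogeneous f \<longleftrightarrow> (\<exists>d. \<forall>m \<in> Poly_Mapping.keys f. monom_degree m = d)"

definition strength_decomposition ::
    "'x set \<Rightarrow> ('x, 'k::comm_ring_1) mpoly \<Rightarrow> nat \<Rightarrow>
     (nat \<Rightarrow> ('x, 'k) mpoly) \<Rightarrow> (nat \<Rightarrow> ('x, 'k) mpoly) \<Rightarrow> bool" where
  "strength_decomposition X f r g h \<longleftrightarrow>
     (\<forall>i<r. g i \<in> polys_in X \<and> homogeneous (g i) \<and>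
            0 < total_degree (g i) \<and> total_degree (g i) < total_degree f \<and>
            h i \<in> polys_in X \<and> homogeneous (h i) \<and>
            0 < total_degree (h i) \<and> total_degree (h i) < total_degree f) \<and>
     f = (\<Sum>i<r. g i * h i)"

text \<open>
  Meant for finite \<open>X\<close> and homogeneous \<open>f\<close> in \<open>polys_in X\<close> of degree at least 2. Such an \<open>f\<close>
  always has a decomposition (split a variable off every monomial), so the minimum exists.
\<close>

definition strength :: "'x set \<Rightarrow> ('x, 'k::comm_ring_1) mpoly \<Rightarrow> nat" where
  "strength X f = (LEAST r. \<exists>g h. strength_decomposition X f r g h)"

definition generic_matrix :: "nat \<Rightarrow> (nat \<times> nat, 'k::comm_ring_1) mpoly mat" where
  "generic_matrix n = mat n n var"

definition generic_det :: "nat \<Rightarrow> (nat \<times> nat, 'k::comm_ring_1) mpoly" where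
  "generic_det n = det (generic_matrix n)"

end

theory Submission
  imports Defs "HOL-Number_Theory.Cong"
begin

text \<open>
  Let \<open>E\<close> be the field of rational functions over \<open>K\<close> in \<open>p\<close> variables, with \<open>\<sigma>\<close> permuting the
  variables cyclically. Conjugating \<open>diag(y\<^sub>0, \<dots>, y\<^sub>p\<^sub>-\<^sub>1)\<close> by a Vandermonde matrix of a \<open>\<sigma>\<close>-orbit
  gives a matrix of linear forms over \<open>E\<close> that is invariant under the semilinear automorphism
  \<open>\<tau>\<close> with \<open>\<tau> y\<^sub>j = y\<^sub>j\<^sub>+\<^sub>1\<close>. Substituting it into a decomposition \<open>det = \<Sum> g\<^sub>i h\<^sub>i\<close> with fewer than
  \<open>p\<close> summands puts \<open>y\<^sub>0 \<cdots> y\<^sub>p\<^sub>-\<^sub>1\<close> into an ideal generated by \<open>p - 1\<close> \<open>\<tau>\<close>-invariant forms \<open>G\<^sub>i\<close> whose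
  degrees \<open>a\<^sub>i\<close> are prime to \<open>p\<close> (missing ones are padded by \<open>0\<close>, in degree 1).

  A graded \<open>\<tau>\<close>-module killed by \<open>y\<^sub>0 \<cdots> y\<^sub>p\<^sub>-\<^sub>1\<close> has dimension divisible by \<open>p\<close> in large degrees: its
  support consists of proper coordinate strata, and \<open>\<tau>\<close> permutes the proper nonempty ones freely
  because \<open>p\<close> is prime. Replacing a module \<open>M\<close> successively by the cokernel and the kernel of \<open>G\<^sub>i\<close> on \<open>M\<close>
  turns the \<open>a\<^sub>i\<close>-difference of the Hilbert function of \<open>M\<close> into Hilbert functions of modules killed by
  \<open>G\<^sub>i\<close>; no regularity of the \<open>G\<^sub>i\<close> is needed. Starting from the polynomial ring this ends with
  the constant \<open>\<Prod> a\<^sub>i\<close>, which would be divisible by \<open>p\<close>. The upper bound is the expansion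
  along the first row.
\<close>

section \<open>Dimensions of semilinearly isomorphic quotients\<close>

text \<open>\<open>T\<close> induces a \<sigma>-semilinear bijection from
  \<open>A\<close>/\<open>B\<close> to \<open>A'\<close>/\<open>B'\<close>. If a set
  \<open>X\<close> extends a basis of \<open>B\<close> to a basis of \<open>A\<close>, then the
  image of \<open>X\<close> under \<open>T\<close> extends a basis of \<open>B'\<close> to a basis
  of \<open>A'\<close>.\<close>

lemma (in vector_space) dim_diff_eq_if_semilinear_quotient_iso:
  fixes T :: "'b \<Rightarrow> 'b" and \<sigma> :: "'a \<Rightarrow> 'a"
  assumes sub: "subspace A" "subspace B" "subspace A'" "subspace B'"
    and le: "B \<subseteq> A" "B' \<subseteq> A'"
    and fin: "finite W" "A \<subseteq> span W" "finite W'" "A' \<subseteq> span W'"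
    and T_add: "\<And>u v. T (u + v) = T u + T v"
    and T_scale: "\<And>c v. T (scale c v) = scale (\<sigma> c) (T v)"
    and surj: "surj \<sigma>"
    and maps: "\<And>v. v \<in> A \<Longrightarrow> T v \<in> A'"
    and inj: "\<And>v. v \<in> A \<Longrightarrow> T v \<in> B' \<longleftrightarrow> v \<in> B"
    and onto: "\<And>w. w \<in> A' \<Longrightarrow> \<exists>v\<in>A. w - T v \<in> B'"
  shows "int (dim A) - int (dim B) = int (dim A') - int (dim B')"
proof -
  have T_diff: "T (u - v) = T u - T v" for u v
    using T_add[of "u - v" v] by (simp add: algebra_simps)
  have T_zero: "T 0 = 0" using T_diff[of 0 0] by simp
  \<comment> \<open>Surjectivity of \<sigma> enters here: every scalar multiple of
    \<open>T v\<close> is the image of a scalar multiple of \<open>v\<close>.\<close>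
  have span_T: "span (T ` X) \<subseteq> T ` span X" for X
  proof (rule span_minimal)
    show "T ` X \<subseteq> T ` span X" by (intro image_mono span_superset)
    show "subspace (T ` span X)"
    proof (rule subspaceI)
      show "0 \<in> T ` span X" using T_zero span_zero[of X] by (metis image_eqI)
      show "x + y \<in> T ` span X" if "x \<in> T ` span X" "y \<in> T ` span X" for x y
      proof -
        from that obtain u v where "u \<in> span X" "v \<in> span X" "x = T u" "y = T v" by blast
        then have "u + v \<in> span X" "x + y = T (u + v)" by (auto simp: span_add T_add)
        then show ?thesis by blast
      qed
      show "scale c x \<in> T ` span X" if "x \<in> T ` span X" for c x
      proof -
        from that obtain v where v: "v \<in> span X" "x = T v" by blast
        obtain c' where "c = \<sigma> c'" using surj by blast
        then have "scale c x = T (scale c' v)" by (simp add: T_scale v)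
        then show ?thesis using v span_scale by blast
      qed
    qed
  qed
  obtain bB where bB: "bB \<subseteq> B" "independent bB" "B \<subseteq> span bB"
    using maximal_independent_subset by blast
  obtain bA where bA: "bB \<subseteq> bA" "bA \<subseteq> A" "independent bA" "A \<subseteq> span bA"
    using maximal_independent_subset_extend[of bB A] bB le by blast
  obtain cB where cB: "cB \<subseteq> B'" "independent cB" "B' \<subseteq> span cB"
    using maximal_independent_subset by blast
  have fin_bA: "finite bA"
    using independent_span_bound[OF fin(1) bA(3)] bA(2) fin(2) by blast
  have fin_cB: "finite cB"
    using independent_span_bound[OF fin(3) cB(2)] cB(1) le(2) fin(4) by blast
  have span_bB: "span bB = B" using bB sub(2) by (simp add: span_subspace)
  have span_cB: "span cB = B'" using cB sub(4) by (simp add: span_subspace)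
  \<comment> \<open>The cardinality is carried along because it says that \<open>T\<close> is
    injective on \<open>X\<close> with values outside \<open>cB\<close>.\<close>
  have ind: "finite X \<Longrightarrow> X \<subseteq> A \<Longrightarrow> X \<inter> bB = {} \<Longrightarrow> independent (X \<union> bB) \<Longrightarrow>
     independent (T ` X \<union> cB) \<and> card (T ` X \<union> cB) = card X + card cB" for X
  proof (induction X rule: finite_induct)
    case empty then show ?case using cB by simp
  next
    case (insert x X)
    have IH: "independent (T ` X \<union> cB)" "card (T ` X \<union> cB) = card X + card cB"
      using insert.IH insert.prems independent_mono[OF insert.prems(3), of "X \<union> bB"] by auto
    have x: "x \<notin> span (X \<union> bB)"
      using insert.prems insert.hyps by (simp add: independent_insert split: if_splits)
    have "T x \<notin> span (T ` X \<union> cB)"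
    proof
      assume "T x \<in> span (T ` X \<union> cB)"
      then obtain u v where uv: "u \<in> span X" "v \<in> B'" "T x = T u + v"
        using span_T[of X] span_cB unfolding span_Un by auto
      have "u \<in> A" using uv(1) insert.prems(1) sub(1) span_minimal by blast
      then have "x - u \<in> A" using insert.prems(1) sub(1) subspace_diff by blast
      moreover have "T (x - u) \<in> B'" using uv by (simp add: T_diff)
      ultimately have "x - u \<in> span bB" using inj span_bB by blast
      then have "u + (x - u) \<in> span (X \<union> bB)" unfolding span_Un using uv(1) by blast
      then show False using x by simp
    qed
    moreover from this have "T x \<notin> T ` X \<union> cB" using span_base[of "T x" "T ` X \<union> cB"] by metis
    ultimately show ?case using IH insert.hyps fin_cB by (simp add: independent_insertI)
  qed
  define X where "X = bA - bB"
  have X: "finite X" "X \<subseteq> A" "X \<inter> bB = {}" "X \<union> bB = bA"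
    using fin_bA bA by (auto simp: X_def)
  note i = ind[OF X(1,2,3)]
  have i1: "independent (T ` X \<union> cB)" "card (T ` X \<union> cB) = card X + card cB"
    using i X(4) bA(3) by auto
  have span_T': "T v \<in> span (T ` X)" if "v \<in> span X" for v
  proof (rule span_induct_alt[OF that, where h="\<lambda>v. T v \<in> span (T ` X)"])
    show "T 0 \<in> span (T ` X)" using T_zero span_zero by simp
    show "T (scale c x + y) \<in> span (T ` X)" if "x \<in> X" "T y \<in> span (T ` X)" for c x y
      using that by (simp add: T_add T_scale span_add span_scale span_base)
  qed
  have "A' \<subseteq> span (T ` X \<union> cB)"
  proof
    fix w assume "w \<in> A'"
    then obtain v where v: "v \<in> A" "w - T v \<in> B'" using onto by blast
    have "v \<in> span (X \<union> bB)" using v bA(4) X(4) by auto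
    then obtain s t where st: "s \<in> span X" "t \<in> B" "v = s + t"
      unfolding span_Un using span_bB by auto
    have "T t \<in> B'" using st le inj by blast
    then have "(w - T v) + T t \<in> span cB"
      using subspace_add[OF sub(4) v(2)] span_cB by simp
    then have "T s + ((w - T v) + T t) \<in> span (T ` X \<union> cB)"
      unfolding span_Un using span_T'[OF st(1)] by blast
    then show "w \<in> span (T ` X \<union> cB)" by (simp add: st(3) T_add)
  qed
  moreover have "T ` X \<union> cB \<subseteq> A'" using maps X(2) cB(1) le by auto
  ultimately have "dim A' = card X + card cB" using basis_card_eq_dim i1 by metis
  moreover have "dim B' = card cB" using basis_card_eq_dim cB by metis
  moreover have "dim A = card X + card bB"
    using basis_card_eq_dim[OF bA(2,4,3)] X fin_bA by (metis card_Un_disjoint finite_Un)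
  moreover have "dim B = card bB" using basis_card_eq_dim bB by metis
  ultimately show ?thesis by simp
qed

section \<open>Polynomials, evaluation and forms\<close>

lemma poly_mapping_sum_single:
  "f = (\<Sum>k\<in>Poly_Mapping.keys f. Poly_Mapping.single k (Poly_Mapping.lookup f k))"
proof (rule poly_mapping_eqI)
  fix k
  have "Poly_Mapping.lookup (\<Sum>k\<in>Poly_Mapping.keys f. Poly_Mapping.single k (Poly_Mapping.lookup f k)) k
      = (\<Sum>l\<in>Poly_Mapping.keys f. if l = k then Poly_Mapping.lookup f k else 0)"
    unfolding lookup_sum by (intro sum.cong refl) (auto simp: lookup_single)
  also have "\<dots> = Poly_Mapping.lookup f k" by (simp add: in_keys_iff)
  finally show "Poly_Mapping.lookup f k = Poly_Mapping.lookup
    (\<Sum>k\<in>Poly_Mapping.keys f. Poly_Mapping.single k (Poly_Mapping.lookup f k)) k" by simp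
qed

lemma mult_conv_sum_single:
  fixes f g :: "'x::comm_monoid_add \<Rightarrow>\<^sub>0 'a::comm_ring_1"
  shows "f * g = (\<Sum>k\<in>Poly_Mapping.keys f. \<Sum>l\<in>Poly_Mapping.keys g.
     Poly_Mapping.single (k + l) (Poly_Mapping.lookup f k * Poly_Mapping.lookup g l))"
proof -
  have "f * g = (\<Sum>k\<in>Poly_Mapping.keys f. Poly_Mapping.single k (Poly_Mapping.lookup f k)) *
      (\<Sum>l\<in>Poly_Mapping.keys g. Poly_Mapping.single l (Poly_Mapping.lookup g l))"
    using poly_mapping_sum_single[of f] poly_mapping_sum_single[of g] by metis
  then show ?thesis by (simp add: sum_product mult_single)
qed

lemma lookup_single_mult:
  fixes f :: "'x::cancel_comm_monoid_add \<Rightarrow>\<^sub>0 'a::comm_ring_1"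
  shows "Poly_Mapping.lookup (Poly_Mapping.single k c * f) (k + l) = c * Poly_Mapping.lookup f l"
proof (cases "c = 0")
  case False
  then have "Poly_Mapping.lookup (Poly_Mapping.single k c * f) (k + l)
      = (\<Sum>m\<in>Poly_Mapping.keys f. if m = l then c * Poly_Mapping.lookup f m else 0)"
    unfolding mult_conv_sum_single lookup_sum
    using False by (simp add: lookup_sum lookup_single when_def)
  also have "\<dots> = c * Poly_Mapping.lookup f l" by (simp add: in_keys_iff)
  finally show ?thesis .
qed simp

lemma keys_single_mult_one:
  fixes f :: "'x::cancel_comm_monoid_add \<Rightarrow>\<^sub>0 'a::comm_ring_1"
  shows "Poly_Mapping.keys (Poly_Mapping.single k 1 * f) = (+) k ` Poly_Mapping.keys f"
proof
  show "Poly_Mapping.keys (Poly_Mapping.single k 1 * f) \<subseteq> (+) k ` Poly_Mapping.keys f"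
    using keys_mult[of "Poly_Mapping.single k (1::'a)" f] by (auto split: if_splits)
  show "(+) k ` Poly_Mapping.keys f \<subseteq> Poly_Mapping.keys (Poly_Mapping.single k 1 * f)"
    by (auto simp: in_keys_iff lookup_single_mult)
qed

lemma lookup_const_mult:
  fixes f :: "'x::cancel_comm_monoid_add \<Rightarrow>\<^sub>0 'a::comm_ring_1"
  shows "Poly_Mapping.lookup (Poly_Mapping.single 0 c * f) l = c * Poly_Mapping.lookup f l"
  using lookup_single_mult[of 0 c f l] by simp

section \<open>Evaluation of monomials and polynomials\<close>

definition mval :: "('x \<Rightarrow> 'r::comm_ring_1) \<Rightarrow> ('x \<Rightarrow>\<^sub>0 nat) \<Rightarrow> 'r" where
  "mval v m = (\<Prod>x\<in>Poly_Mapping.keys m. v x ^ Poly_Mapping.lookup m x)"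

lemma mval_superset:
  assumes "finite X" "Poly_Mapping.keys m \<subseteq> X"
  shows "mval v m = (\<Prod>x\<in>X. v x ^ Poly_Mapping.lookup m x)"
  unfolding mval_def using assms by (intro prod.mono_neutral_left) (auto simp: in_keys_iff)

lemma mval_zero [simp]: "mval v 0 = 1"
  by (simp add: mval_def)

lemma mval_add: "mval v (m + n) = mval v m * mval v n"
proof -
  let ?X = "Poly_Mapping.keys m \<union> Poly_Mapping.keys n"
  have "Poly_Mapping.keys (m + n) \<subseteq> ?X" by (rule keys_add)
  then show ?thesis
    by (simp add: mval_superset[of ?X] lookup_add power_add prod.distrib)
qed

lemma mval_single [simp]: "mval v (Poly_Mapping.single x n) = v x ^ n"
  by (simp add: mval_def)

text \<open>Coefficients pass through \<open>\<phi>\<close> as well, so that semilinear ring maps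
  such as \<tau> below are evaluations too.\<close>

definition peval :: "('a::comm_ring_1 \<Rightarrow> 'r::comm_ring_1) \<Rightarrow> ('x \<Rightarrow> 'r) \<Rightarrow> ('x, 'a) mpoly \<Rightarrow> 'r" where
  "peval \<phi> v f = (\<Sum>m\<in>Poly_Mapping.keys f. \<phi> (Poly_Mapping.lookup f m) * mval v m)"

context
  fixes \<phi> :: "'a::comm_ring_1 \<Rightarrow> 'r::comm_ring_1"
  assumes hom: "comm_ring_hom \<phi>"
begin

interpretation comm_ring_hom \<phi> by (rule hom)

lemma peval_superset:
  assumes "finite K" "Poly_Mapping.keys f \<subseteq> K"
  shows "peval \<phi> v f = (\<Sum>m\<in>K. \<phi> (Poly_Mapping.lookup f m) * mval v m)"
  unfolding peval_def using assms by (intro sum.mono_neutral_left) (auto simp: in_keys_iff)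

lemma peval_add: "peval \<phi> v (f + g) = peval \<phi> v f + peval \<phi> v g"
proof -
  let ?K = "Poly_Mapping.keys f \<union> Poly_Mapping.keys g"
  have "Poly_Mapping.keys (f + g) \<subseteq> ?K" by (rule keys_add)
  then show ?thesis
    by (simp add: peval_superset[of ?K] lookup_add hom_add distrib_right sum.distrib)
qed

lemma peval_zero: "peval \<phi> v 0 = 0"
  by (simp add: peval_def)

lemma peval_sum: "peval \<phi> v (\<Sum>i\<in>I. f i) = (\<Sum>i\<in>I. peval \<phi> v (f i))"
  by (induction I rule: infinite_finite_induct) (auto simp: peval_add peval_zero)

lemma peval_single: "peval \<phi> v (Poly_Mapping.single m c) = \<phi> c * mval v m"
  by (cases "c = 0") (auto simp: peval_def)

lemma peval_mult: "peval \<phi> v (f * g) = peval \<phi> v f * peval \<phi> v g"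
proof -
  have "peval \<phi> v (f * g) = (\<Sum>k\<in>Poly_Mapping.keys f. \<Sum>l\<in>Poly_Mapping.keys g.
     (\<phi> (Poly_Mapping.lookup f k) * mval v k) * (\<phi> (Poly_Mapping.lookup g l) * mval v l))"
    unfolding mult_conv_sum_single[of f g] peval_sum peval_single hom_mult mval_add
    by (intro sum.cong refl) (simp add: mult_ac)
  then show ?thesis by (simp add: peval_def sum_product)
qed

lemma peval_comm_ring_hom: "comm_ring_hom (peval \<phi> v)"
proof
  show "peval \<phi> v 1 = 1"
    using peval_single[of v 0 1] by simp
qed (auto simp: peval_add peval_mult peval_zero)

lemma peval_const: "peval \<phi> v (Poly_Mapping.single 0 c) = \<phi> c"
  by (simp add: peval_single)

lemma peval_var: "peval \<phi> v (var x) = v x"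
  by (simp add: var_def peval_single)

end

lemma comm_ring_hom_mval: "comm_ring_hom \<psi> \<Longrightarrow> \<psi> (mval v m) = mval (\<psi> \<circ> v) m"
proof -
  assume "comm_ring_hom \<psi>"
  then interpret comm_ring_hom \<psi> .
  show ?thesis by (simp add: mval_def hom_prod hom_power)
qed

text \<open>A ring map applied after an evaluation changes only the images of constants and
  variables. Together with \<open>peval_id\<close> this reduces an identity between ring
  endomorphisms to constants and variables.\<close>

lemma comm_ring_hom_peval: "comm_ring_hom \<psi> \<Longrightarrow> \<psi> (peval \<phi> v f) = peval (\<psi> \<circ> \<phi>) (\<psi> \<circ> v) f"
proof -
  assume h: "comm_ring_hom \<psi>"
  then interpret comm_ring_hom \<psi> .
  show ?thesis by (simp add: peval_def hom_sum hom_mult comm_ring_hom_mval[OF h])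
qed

lemma comm_ring_hom_funpow:
  fixes \<phi> :: "'r::comm_ring_1 \<Rightarrow> 'r"
  assumes "comm_ring_hom \<phi>"
  shows "comm_ring_hom (\<phi> ^^ i)"
proof (induction i)
  case 0
  show ?case by standard auto
next
  case (Suc i)
  interpret i: comm_ring_hom "\<phi> ^^ i" by (rule Suc)
  interpret comm_ring_hom \<phi> by fact
  show ?case by standard (auto simp: hom_add hom_mult i.hom_add i.hom_mult)
qed

lemma comm_ring_hom_const: "comm_ring_hom (Poly_Mapping.single 0 :: 'a::comm_ring_1 \<Rightarrow> ('x, 'a) mpoly)"
  by standard (auto simp: single_add mult_single)

lemma mval_var: "mval var m = (Poly_Mapping.single m 1 :: ('x, 'a::comm_ring_1) mpoly)"
proof -
  have pw: "(var x :: ('x, 'a) mpoly) ^ n = Poly_Mapping.single (Poly_Mapping.single x n) 1" for x n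
    by (induction n) (auto simp: var_def mult_single single_add[symmetric])
  have pr: "finite X \<Longrightarrow> (\<Prod>x\<in>X. Poly_Mapping.single (f x) (1::'a)) = Poly_Mapping.single (\<Sum>x\<in>X. f x) 1"
    for X :: "'x set" and f :: "'x \<Rightarrow> 'x \<Rightarrow>\<^sub>0 nat"
    by (induction X rule: finite_induct) (auto simp: mult_single)
  show ?thesis
    unfolding mval_def pw by (simp add: pr poly_mapping_sum_single[symmetric])
qed

lemma peval_id: "peval (Poly_Mapping.single 0) var f = f"
  by (simp add: peval_def mval_var mult_single poly_mapping_sum_single[symmetric])

lemma peval_cong:
  assumes "f \<in> polys_in X" "\<And>c. \<phi> c = \<phi>' c" "\<And>x. x \<in> X \<Longrightarrow> v x = v' x"
  shows "peval \<phi> v f = peval \<phi>' v' f"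
  unfolding peval_def mval_def using assms by (auto simp: polys_in_def subset_iff intro!: sum.cong prod.cong)

section \<open>Degrees and spaces of forms\<close>

lemma monom_degree_superset:
  assumes "finite X" "Poly_Mapping.keys m \<subseteq> X"
  shows "monom_degree m = (\<Sum>x\<in>X. Poly_Mapping.lookup m x)"
  unfolding monom_degree_def using assms by (intro sum.mono_neutral_left) (auto simp: in_keys_iff)

lemma monom_degree_add: "monom_degree (m + n) = monom_degree m + monom_degree n"
proof -
  let ?X = "Poly_Mapping.keys m \<union> Poly_Mapping.keys n"
  have "Poly_Mapping.keys (m + n) \<subseteq> ?X" by (rule keys_add)
  then show ?thesis
    by (simp add: monom_degree_superset[of ?X] lookup_add sum.distrib)
qed

lemma monom_degree_zero [simp]: "monom_degree 0 = 0"
  by (simp add: monom_degree_def)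

lemma monom_degree_single [simp]: "monom_degree (Poly_Mapping.single x n) = n"
  by (simp add: monom_degree_def)

lemma keys_add_nat: "Poly_Mapping.keys (m + n) = Poly_Mapping.keys m \<union> Poly_Mapping.keys n"
  for m n :: "'x \<Rightarrow>\<^sub>0 nat"
  by (auto simp: in_keys_iff lookup_add)

definition monoms :: "'x set \<Rightarrow> nat \<Rightarrow> ('x \<Rightarrow>\<^sub>0 nat) set" where
  "monoms X d = {m. Poly_Mapping.keys m \<subseteq> X \<and> monom_degree m = d}"

text \<open>Zero belongs to every degree, whereas \<open>total_degree\<close> gives it degree 0;
  this makes each \<open>forms X d\<close> a vector space.\<close>

definition forms :: "'x set \<Rightarrow> nat \<Rightarrow> ('x, 'a::comm_ring_1) mpoly set" where
  "forms X d = {f. Poly_Mapping.keys f \<subseteq> monoms X d}"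

lemma forms_subset_polys_in: "forms X d \<subseteq> polys_in X"
  by (auto simp: forms_def polys_in_def monoms_def)

lemma monoms_add: "m \<in> monoms X d \<Longrightarrow> n \<in> monoms X e \<Longrightarrow> m + n \<in> monoms X (d + e)"
  by (auto simp: monoms_def keys_add_nat monom_degree_add)

lemma forms_zero [simp]: "0 \<in> forms X d"
  by (simp add: forms_def)

lemma forms_add: "f \<in> forms X d \<Longrightarrow> g \<in> forms X d \<Longrightarrow> f + g \<in> forms X d"
  unfolding forms_def using keys_add[of f g] by blast

lemma forms_sum: "(\<And>i. i \<in> I \<Longrightarrow> f i \<in> forms X d) \<Longrightarrow> (\<Sum>i\<in>I. f i) \<in> forms X d"
  by (induction I rule: infinite_finite_induct) (auto simp: forms_add)

lemma forms_mult: "f \<in> forms X d \<Longrightarrow> g \<in> forms X e \<Longrightarrow> f * g \<in> forms X (d + e)"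
  unfolding forms_def using keys_mult[of f g] by (auto intro!: monoms_add)

lemma forms_const: "Poly_Mapping.single 0 c \<in> forms X 0"
  by (auto simp: forms_def monoms_def)

lemma forms_scale: "f \<in> forms X d \<Longrightarrow> Poly_Mapping.single 0 c * f \<in> forms X d"
  using forms_mult[OF forms_const] by fastforce

lemma forms_single: "m \<in> monoms X d \<Longrightarrow> Poly_Mapping.single m c \<in> forms X d"
  by (auto simp: forms_def)

lemma forms_var: "x \<in> X \<Longrightarrow> var x \<in> forms X 1"
  unfolding var_def by (intro forms_single) (auto simp: monoms_def split: if_splits)

lemma forms_power: "f \<in> forms X d \<Longrightarrow> f ^ n \<in> forms X (n * d)"
  using forms_const[of 1 X] by (induction n) (auto simp: forms_mult)

lemma forms_one: "1 \<in> forms X 0"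
  using forms_const[of 1 X] by simp

lemma forms_prod: "(\<And>i. i \<in> I \<Longrightarrow> f i \<in> forms X (d i)) \<Longrightarrow> (\<Prod>i\<in>I. f i) \<in> forms X (\<Sum>i\<in>I. d i)"
  by (induction I rule: infinite_finite_induct) (auto simp: forms_mult forms_one)

text \<open>Substituting linear forms turns a monomial of degree \<open>d\<close> into a product of
  \<open>d\<close> linear forms, so degrees are preserved.\<close>

lemma peval_forms:
  assumes "f \<in> forms X d" "\<And>c. \<phi> c \<in> forms Y 0" "\<And>x. x \<in> X \<Longrightarrow> v x \<in> forms Y 1"
  shows "peval \<phi> v f \<in> forms Y d"
  unfolding peval_def
proof (rule forms_sum)
  fix m assume "m \<in> Poly_Mapping.keys f"
  then have m: "Poly_Mapping.keys m \<subseteq> X" "monom_degree m = d"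
    using assms(1) by (auto simp: forms_def monoms_def)
  have "mval v m \<in> forms Y (\<Sum>x\<in>Poly_Mapping.keys m. Poly_Mapping.lookup m x * 1)"
    unfolding mval_def by (intro forms_prod forms_power assms(3)) (use m in auto)
  then have "mval v m \<in> forms Y d" using m(2) by (simp add: monom_degree_def)
  then show "\<phi> (Poly_Mapping.lookup f m) * mval v m \<in> forms Y d"
    using forms_mult[OF assms(2)] by fastforce
qed

lemma finite_monoms: "finite X \<Longrightarrow> finite (monoms X d)"
proof -
  assume X: "finite X"
  have "Poly_Mapping.lookup ` monoms X d \<subseteq> {f. \<forall>x. (x \<in> X \<longrightarrow> f x \<in> {..d}) \<and> (x \<notin> X \<longrightarrow> f x = 0)}"
  proof (intro image_subsetI CollectI allI conjI impI)
    fix m x assume m: "m \<in> monoms X d"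
    then have d: "(\<Sum>x\<in>X. Poly_Mapping.lookup m x) = d"
      using X by (auto simp: monoms_def monom_degree_superset)
    show "Poly_Mapping.lookup m x \<in> {..d}" if "x \<in> X"
      using d member_le_sum[OF that, of "Poly_Mapping.lookup m"] X by auto
    show "Poly_Mapping.lookup m x = 0" if "x \<notin> X"
      using m that by (auto simp: monoms_def in_keys_iff)
  qed
  moreover have "finite {f. \<forall>x. (x \<in> X \<longrightarrow> f x \<in> {..d}) \<and> (x \<notin> X \<longrightarrow> f x = (0::nat))}"
    using X by (intro finite_set_of_finite_funs) auto
  ultimately have "finite (Poly_Mapping.lookup ` monoms X d)" by (rule finite_subset)
  then show ?thesis by (rule finite_imageD) (simp add: inj_on_def lookup_inject)
qed

text \<open>Stars and bars: exponent vectors are lists of length \<open>Suc n\<close> with sum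
  \<open>d\<close>.\<close>

lemma card_monoms: "card (monoms {..<Suc n} d) = (d + n) choose n"
proof -
  let ?L = "{l. length l = Suc n \<and> sum_list l = d}"
  let ?f = "\<lambda>m. map (Poly_Mapping.lookup m) [0..<Suc n]"
  have deg: "monom_degree m = sum_list (?f m)" if "Poly_Mapping.keys m \<subseteq> {..<Suc n}" for m
    using that by (simp add: monom_degree_superset[of "{..<Suc n}"] interv_sum_list_conv_sum_set_nat
        lessThan_atLeast0 del: upt_Suc)
  have "bij_betw ?f (monoms {..<Suc n} d) ?L"
  proof (rule bij_betwI')
    fix m m' assume *: "m \<in> monoms {..<Suc n} d" "m' \<in> monoms {..<Suc n} d"
    show "(?f m = ?f m') = (m = m')"
    proof
      assume eq: "?f m = ?f m'"
      show "m = m'"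
      proof (rule poly_mapping_eqI)
        fix x show "Poly_Mapping.lookup m x = Poly_Mapping.lookup m' x"
        proof (cases "x < Suc n")
          case True
          then show ?thesis using arg_cong[OF eq, of "\<lambda>l. l ! x"] by (simp del: upt_Suc)
        next
          case False
          then have "x \<notin> Poly_Mapping.keys m" "x \<notin> Poly_Mapping.keys m'"
            using * by (auto simp: monoms_def)
          then show ?thesis by (simp add: in_keys_iff)
        qed
      qed
    qed simp
  next
    fix m assume "m \<in> monoms {..<Suc n} d"
    then show "?f m \<in> ?L" using deg[of m] by (auto simp: monoms_def simp del: upt_Suc)
  next
    fix l assume l: "l \<in> ?L"
    \<comment> \<open>\<open>Poly_Mapping.nth\<close> pads the list by zeros beyond its end.\<close>
    define m where "m = Poly_Mapping.nth l"
    have k: "Poly_Mapping.keys m \<subseteq> {..<Suc n}" using l by (auto simp: m_def in_set_enumerate_eq)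
    have "?f m = l" using l by (intro nth_equalityI) (auto simp: m_def nth_default_def simp del: upt_Suc)
    then show "\<exists>m\<in>monoms {..<Suc n} d. l = ?f m"
    proof (intro bexI)
      show "m \<in> monoms {..<Suc n} d" using k deg[OF k] \<open>?f m = l\<close> l by (simp add: monoms_def del: upt_Suc)
    qed (simp only: \<open>?f m = l\<close>)
  qed
  then have "card (monoms {..<Suc n} d) = card ?L" by (rule bij_betw_same_card)
  also have "\<dots> = (d + n) choose d" by (subst card_length_sum_list) simp
  also have "\<dots> = (d + n) choose n" by (subst binomial_symmetric) auto
  finally show ?thesis .
qed

section \<open>Graded ideals and the ascending chain condition\<close>

text \<open>Every sequence has a monotone subsequence, and a decreasing one in the naturals is
  constant from the place of its minimum on.\<close>

lemma nat_seq_mono_subseq: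
  fixes f :: "nat \<Rightarrow> nat"
  shows "\<exists>r. strict_mono r \<and> incseq (f \<circ> r)"
proof -
  obtain r where r: "strict_mono r" "monoseq (f \<circ> r)"
    using seq_monosub[of f] by (auto simp: o_def)
  show ?thesis
  proof (cases "incseq (f \<circ> r)")
    case False
    then have dec: "decseq (f \<circ> r)" using r(2) by (simp add: monoseq_iff)
    obtain i where i: "\<And>j. (f \<circ> r) i \<le> (f \<circ> r) j"
      using ex_has_least_nat[of "\<lambda>_. True" 0 "f \<circ> r"] by auto
    have "f (r (k + i)) = f (r i)" for k
    proof (rule antisym)
      show "f (r (k + i)) \<le> f (r i)" using decseqD[OF dec, of i "k + i"] by simp
      show "f (r i) \<le> f (r (k + i))" using i[of "k + i"] by simp
    qed
    then have "incseq (f \<circ> (\<lambda>k. r (k + i)))" by (simp add: incseq_def)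
    moreover have "strict_mono (\<lambda>k. r (k + i))" using r(1) by (simp add: strict_mono_def)
    ultimately show ?thesis by blast
  qed (use r in blast)
qed

text \<open>The sequence is thinned out for one variable after the other; passing to a subsequence
  keeps the monotonicity already reached.\<close>

lemma dickson_subseq:
  fixes s :: "nat \<Rightarrow> 'x \<Rightarrow> nat"
  assumes "finite X"
  shows "\<exists>r. strict_mono r \<and> (\<forall>x\<in>X. incseq (\<lambda>i. s (r i) x))"
  using assms
proof (induction X rule: finite_induct)
  case empty
  show ?case using strict_mono_id by auto
next
  case (insert y X)
  then obtain r where r: "strict_mono r" "\<forall>x\<in>X. incseq (\<lambda>i. s (r i) x)" by blast
  obtain q where q: "strict_mono q" "incseq ((\<lambda>i. s (r i) y) \<circ> q)"
    using nat_seq_mono_subseq by blast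
  have "incseq (\<lambda>i. s ((r \<circ> q) i) x)" if "x \<in> insert y X" for x
  proof (cases "x = y")
    case False
    then have "incseq (\<lambda>i. s (r i) x)" using r that by blast
    then show ?thesis using q(1) by (simp add: incseq_def strict_mono_less_eq)
  qed (use q in \<open>simp add: o_def\<close>)
  moreover have "strict_mono (r \<circ> q)" using r q by (simp add: strict_mono_o)
  ultimately show ?case by blast
qed

text \<open>Dickson's lemma: in a subsequence along which all exponents increase weakly, the first
  monomial divides the second.\<close>

lemma dickson:
  fixes s :: "nat \<Rightarrow> 'x \<Rightarrow>\<^sub>0 nat"
  assumes "finite X" "\<And>i. Poly_Mapping.keys (s i) \<subseteq> X"
  obtains i j k where "i < j" "s j = k + s i"
proof -
  obtain r where r: "strict_mono r" "\<forall>x\<in>X. incseq (\<lambda>i. Poly_Mapping.lookup (s (r i)) x)"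
    using dickson_subseq[OF assms(1), of "\<lambda>i. Poly_Mapping.lookup (s i)"] by blast
  have le: "Poly_Mapping.lookup (s (r 0)) x \<le> Poly_Mapping.lookup (s (r 1)) x" for x
  proof (cases "x \<in> X")
    case True
    then show ?thesis using r(2) by (simp add: incseq_def)
  next
    case False
    then have "x \<notin> Poly_Mapping.keys (s (r 0))" using assms(2) by blast
    then show ?thesis by (simp add: in_keys_iff)
  qed
  have "s (r 1) = (s (r 1) - s (r 0)) + s (r 0)"
    by (rule poly_mapping_eqI) (use le in \<open>simp add: lookup_add lookup_minus\<close>)
  moreover have "r 0 < r 1" using r(1) by (simp add: strict_mono_def)
  ultimately show ?thesis using that by blast
qed

text \<open>A homogeneous ideal of the polynomial ring in \<open>X\<close>, given by its components.
  Closure under scalars is the case \<open>e = 0\<close> of the multiplication rule.\<close>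

definition graded_ideal :: "'x set \<Rightarrow> (nat \<Rightarrow> ('x, 'a::comm_ring_1) mpoly set) \<Rightarrow> bool" where
  "graded_ideal X A \<longleftrightarrow>
     (\<forall>d. A d \<subseteq> forms X d \<and> 0 \<in> A d \<and> (\<forall>f\<in>A d. \<forall>g\<in>A d. f + g \<in> A d)) \<and>
     (\<forall>d e. \<forall>f\<in>forms X e. \<forall>g\<in>A d. f * g \<in> A (e + d))"

lemma graded_idealD:
  assumes "graded_ideal X A"
  shows "A d \<subseteq> forms X d" "0 \<in> A d" "f \<in> A d \<Longrightarrow> g \<in> A d \<Longrightarrow> f + g \<in> A d"
    "h \<in> forms X e \<Longrightarrow> g \<in> A d \<Longrightarrow> h * g \<in> A (e + d)"
  using assms by (auto simp: graded_ideal_def)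

lemma graded_ideal_scale:
  assumes "graded_ideal X A" "f \<in> A d"
  shows "Poly_Mapping.single 0 c * f \<in> A d"
  using graded_idealD(4)[OF assms(1) forms_const assms(2)] by simp

lemma graded_ideal_minus:
  assumes "graded_ideal X A" "f \<in> A d"
  shows "- f \<in> A d"
  using graded_ideal_scale[OF assms, of "-1"] by (simp add: single_uminus)

lemma graded_ideal_diff:
  assumes "graded_ideal X A" "f \<in> A d" "g \<in> A d"
  shows "f - g \<in> A d"
  using graded_idealD(3)[OF assms(1,2) graded_ideal_minus[OF assms(1,3)]] by simp

lemma graded_ideal_sum:
  assumes "graded_ideal X A" "\<And>i. i \<in> I \<Longrightarrow> f i \<in> A d"
  shows "(\<Sum>i\<in>I. f i) \<in> A d"
  using assms(2) by (induction I rule: infinite_finite_induct) (auto intro: graded_idealD[OF assms(1)])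

lemma graded_ideal_forms: "graded_ideal X (forms X)"
  by (auto simp: graded_ideal_def forms_add forms_mult)

lemma graded_ideal_zero: "graded_ideal X (\<lambda>d. {0})"
  by (auto simp: graded_ideal_def)

section \<open>Leading monomials and the ascending chain condition\<close>

definition lead_monom :: "('x::linorder, 'a::comm_ring_1) mpoly \<Rightarrow> ('x \<Rightarrow>\<^sub>0 nat)" where
  "lead_monom f = Max (Poly_Mapping.keys f)"

lemma lead_monom_in_keys: "f \<noteq> 0 \<Longrightarrow> lead_monom f \<in> Poly_Mapping.keys f"
  unfolding lead_monom_def by (intro Max_in) auto

lemma lead_monom_single_mult:
  fixes f :: "('x::linorder, 'a::comm_ring_1) mpoly"
  assumes "f \<noteq> 0"
  shows "lead_monom (Poly_Mapping.single k 1 * f) = k + lead_monom f"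
proof -
  have "mono ((+) k)" by (simp add: mono_def add_left_mono)
  then show ?thesis
    unfolding lead_monom_def keys_single_mult_one using assms by (simp add: mono_Max_commute)
qed

text \<open>Division: a scalar multiple of an element of \<open>A d\<close> with the same leading
  monomial cancels the leading term of \<open>f\<close>, and the remainder still lies in
  \<open>B d\<close>.\<close>

lemma graded_ideal_eq_if_lead_monoms:
  fixes A B :: "nat \<Rightarrow> ('x::linorder, 'a::field) mpoly set"
  assumes X: "finite X" and A: "graded_ideal X A" and B: "graded_ideal X B"
    and le: "A d \<subseteq> B d"
    and lead: "\<And>g. g \<in> B d \<Longrightarrow> g \<noteq> 0 \<Longrightarrow> \<exists>h\<in>A d. h \<noteq> 0 \<and> lead_monom h = lead_monom g"
    and f: "f \<in> B d"
  shows "f \<in> A d"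
  using f
\<comment> \<open>The measure counts the monomials of degree \<open>d\<close> bounded by some
  monomial of \<open>f\<close>. It is finite because the degree is fixed, and it drops because the
  leading monomial is lost.\<close>
proof (induction "card {k \<in> monoms X d. \<exists>l\<in>Poly_Mapping.keys f. k \<le> l}" arbitrary: f rule: less_induct)
  case less
  show ?case
  proof (cases "f = 0")
    case True
    then show ?thesis using graded_idealD(2)[OF A] by simp
  next
    case False
    obtain h where h: "h \<in> A d" "h \<noteq> 0" "lead_monom h = lead_monom f"
      using lead less.prems False by blast
    let ?l = "lead_monom f"
    define c where "c = Poly_Mapping.lookup f ?l / Poly_Mapping.lookup h ?l"
    define f' where "f' = f - Poly_Mapping.single 0 c * h"
    have hl: "Poly_Mapping.lookup h ?l \<noteq> 0"
      using lead_monom_in_keys[OF h(2)] by (simp add: in_keys_iff h(3))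
    have f'B: "f' \<in> B d"
      unfolding f'_def using h(1) le less.prems by (intro graded_ideal_diff[OF B] graded_ideal_scale[OF B]) auto
    have "Poly_Mapping.lookup f' ?l = 0"
      using hl by (simp add: f'_def lookup_minus lookup_const_mult c_def)
    then have nk: "?l \<notin> Poly_Mapping.keys f'" by (simp add: in_keys_iff)
    have less_l: "k < ?l" if "k \<in> Poly_Mapping.keys f'" for k
    proof -
      have "k \<in> Poly_Mapping.keys f \<or> k \<in> Poly_Mapping.keys h"
        using that by (auto simp: in_keys_iff f'_def lookup_minus lookup_const_mult)
      then have "k \<le> ?l" using h(3) by (metis Max_ge finite_keys lead_monom_def)
      then show ?thesis using that nk by (metis order_le_less)
    qed
    let ?S = "\<lambda>f. {k \<in> monoms X d. \<exists>l\<in>Poly_Mapping.keys f. k \<le> l}"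
    have lk: "?l \<in> Poly_Mapping.keys f" by (rule lead_monom_in_keys[OF False])
    then have "?l \<in> monoms X d" using less.prems graded_idealD(1)[OF B, of d] by (auto simp: forms_def)
    then have "?l \<in> ?S f" using lk by blast
    moreover have "?l \<notin> ?S f'" using less_l by (auto simp: not_le)
    moreover have "?S f' \<subseteq> ?S f" using less_l lk by (blast intro: order_trans less_imp_le)
    ultimately have "?S f' \<subset> ?S f" by blast
    then have "card (?S f') < card (?S f)"
      using finite_monoms[OF X, of d] by (intro psubset_card_mono) auto
    then have "f' \<in> A d" using less.hyps f'B by blast
    then have "f' + Poly_Mapping.single 0 c * h \<in> A d"
      using graded_idealD(3)[OF A] graded_ideal_scale[OF A h(1)] by blast
    then show ?thesis by (simp add: f'_def)
  qed
qed

text \<open>If every step were proper, each would contribute some \<open>g i\<close> whose leading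
  monomial does not occur in \<open>A i\<close>. By Dickson's lemma one of these divides a later
  one, that of \<open>g j\<close>; the corresponding multiple of \<open>g i\<close> lies in
  \<open>A j\<close> and has the leading monomial of \<open>g j\<close>, a contradiction.\<close>

theorem graded_ideal_noetherian:
  fixes A :: "nat \<Rightarrow> nat \<Rightarrow> ('x::linorder, 'a::field) mpoly set"
  assumes X: "finite X" and A: "\<And>i. graded_ideal X (A i)" and le: "\<And>i d. A i d \<subseteq> A (Suc i) d"
  shows "\<exists>i. A (Suc i) = A i"
proof (rule ccontr)
  assume no: "\<nexists>i. A (Suc i) = A i"
  have "\<exists>d g. g \<in> A (Suc i) d \<and> g \<noteq> 0 \<and> (\<forall>h\<in>A i d. h \<noteq> 0 \<longrightarrow> lead_monom h \<noteq> lead_monom g)" for i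
  proof (rule ccontr)
    assume "\<not> ?thesis"
    then have "\<exists>h\<in>A i d. h \<noteq> 0 \<and> lead_monom h = lead_monom g"
      if "g \<in> A (Suc i) d" "g \<noteq> 0" for g d
      using that by blast
    then have "A (Suc i) d \<subseteq> A i d" for d
      using graded_ideal_eq_if_lead_monoms[OF X A A le] by blast
    then have "A (Suc i) = A i" using le by (intro ext) blast
    then show False using no by blast
  qed
  then obtain d g where g: "\<And>i. g i \<in> A (Suc i) (d i)" "\<And>i. g i \<noteq> 0"
    "\<And>i h. h \<in> A i (d i) \<Longrightarrow> h \<noteq> 0 \<Longrightarrow> lead_monom h \<noteq> lead_monom (g i)" by metis
  have lm: "lead_monom (g i) \<in> monoms X (d i)" for i
    using lead_monom_in_keys[OF g(2), of i] g(1)[of i] graded_idealD(1)[OF A, of "Suc i" "d i"]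
    by (auto simp: forms_def)
  then have "Poly_Mapping.keys (lead_monom (g i)) \<subseteq> X" for i by (auto simp: monoms_def)
  then obtain i j k where ijk: "i < j" "lead_monom (g j) = k + lead_monom (g i)"
    using dickson[OF X, of "\<lambda>i. lead_monom (g i)"] by metis
  have "d j = monom_degree k + d i"
    using lm[of i] lm[of j] by (simp add: monoms_def ijk(2) monom_degree_add)
  moreover have "k \<in> monoms X (monom_degree k)"
    using lm[of j] by (simp add: monoms_def ijk(2) keys_add_nat)
  ultimately have "Poly_Mapping.single k 1 * g i \<in> A (Suc i) (d j)"
    using graded_idealD(4)[OF A forms_single g(1)] by metis
  moreover have "A (Suc i) (d j) \<subseteq> A j (d j)"
    using lift_Suc_mono_le[of "\<lambda>i. A i (d j)" "Suc i" j] le ijk(1) by simp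
  moreover have "Poly_Mapping.single k 1 * g i \<noteq> 0"
  proof
    assume "Poly_Mapping.single k 1 * g i = 0"
    then have "(+) k ` Poly_Mapping.keys (g i) = {}" using keys_single_mult_one[of k "g i"] by (metis keys_zero)
    then show False using lead_monom_in_keys[OF g(2), of i] by blast
  qed
  ultimately show False
    using g(3) lead_monom_single_mult[OF g(2), of k i] ijk(2) by (metis subsetD)
qed

section \<open>Hilbert functions and cyclic actions\<close>

definition smul :: "'a::field \<Rightarrow> ('x, 'a) mpoly \<Rightarrow> ('x, 'a) mpoly" where
  "smul c f = Poly_Mapping.single 0 c * f"

interpretation mpoly: vector_space smul
  by standard (auto simp: smul_def algebra_simps single_add mult_single simp flip: mult.assoc)

lemma subspace_graded_ideal: "graded_ideal X A \<Longrightarrow> mpoly.subspace (A d)"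
  by (intro mpoly.subspaceI) (auto simp: smul_def graded_idealD graded_ideal_scale)

abbreviation monom_basis :: "'x set \<Rightarrow> nat \<Rightarrow> ('x, 'a::field) mpoly set" where
  "monom_basis X d \<equiv> (\<lambda>m. Poly_Mapping.single m 1) ` monoms X d"

lemma forms_subset_span:
  "(forms X d :: ('x, 'a::field) mpoly set) \<subseteq> mpoly.span (monom_basis X d)"
proof
  fix f :: "('x, 'a) mpoly" assume f: "f \<in> forms X d"
  have "(\<Sum>k\<in>Poly_Mapping.keys f. smul (Poly_Mapping.lookup f k) (Poly_Mapping.single k 1))
      \<in> mpoly.span (monom_basis X d)"
    using f by (intro mpoly.span_sum mpoly.span_scale mpoly.span_base) (auto simp: forms_def)
  then show "f \<in> mpoly.span (monom_basis X d)"
    by (simp add: smul_def mult_single flip: poly_mapping_sum_single)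
qed

text \<open>The Hilbert function, integer-valued because the argument lives on differences of its
  values.\<close>

definition hilb :: "(nat \<Rightarrow> ('x, 'a::field) mpoly set) \<Rightarrow> nat \<Rightarrow> int" where
  "hilb A d = int (mpoly.dim (A d))"

lemma hilb_forms:
  assumes "finite X"
  shows "hilb (forms X :: nat \<Rightarrow> ('x, 'a::field) mpoly set) d = int (card (monoms X d))"
proof -
  let ?s = "\<lambda>m. Poly_Mapping.single m (1::'a)"
  have inj: "inj ?s"
    by (auto simp: inj_on_def poly_mapping_eq_iff fun_eq_iff lookup_single when_def split: if_splits)
  have "mpoly.independent (monom_basis X d :: ('x, 'a) mpoly set)"
  proof (rule mpoly.independent_if_scalars_zero)
    fix u :: "('x, 'a) mpoly \<Rightarrow> 'a" and x :: "('x, 'a) mpoly"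
    assume 0: "(\<Sum>x\<in>monom_basis X d. smul (u x) x) = 0" and "x \<in> monom_basis X d"
    then obtain m where m: "m \<in> monoms X d" "x = ?s m" by blast
    have "(\<Sum>k\<in>monoms X d. Poly_Mapping.single k (u (?s k))) = 0"
      using 0 by (simp add: sum.reindex[OF inj_on_subset[OF inj]] smul_def mult_single)
    then have "Poly_Mapping.lookup (\<Sum>k\<in>monoms X d. Poly_Mapping.single k (u (?s k))) m = 0"
      by simp
    then have "(\<Sum>k\<in>monoms X d. if k = m then u (?s k) else 0) = 0"
      by (simp add: lookup_sum lookup_single when_def)
    then show "u x = 0" using m finite_monoms[OF assms, of d] by simp
  qed (use finite_monoms[OF assms] in simp)
  moreover have "monom_basis X d \<subseteq> (forms X d :: ('x, 'a) mpoly set)" by (auto intro: forms_single)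
  ultimately have "card (monom_basis X d :: ('x, 'a) mpoly set) = mpoly.dim (forms X d :: ('x, 'a) mpoly set)"
    using forms_subset_span by (intro mpoly.basis_card_eq_dim)
  then show ?thesis
    by (simp add: hilb_def card_image[OF inj_on_subset[OF inj]])
qed

text \<open>Two degrees \<open>d\<close> and \<open>e\<close> are allowed because \<open>T\<close>
  will be either a power of \<tau>, which keeps the degree, or multiplication by a form, which
  raises it.\<close>

lemma hilb_diff_eq_if_semilinear:
  fixes T :: "('x, 'a::field) mpoly \<Rightarrow> ('x, 'a) mpoly"
  assumes "finite X"
    and "graded_ideal X A" "graded_ideal X B" "graded_ideal X A'" "graded_ideal X B'"
    and "B d \<subseteq> A d" "B' e \<subseteq> A' e"
    and "\<And>u v. T (u + v) = T u + T v"
    and "\<And>c v. T (Poly_Mapping.single 0 c * v) = Poly_Mapping.single 0 (\<sigma> c) * T v"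
    and "surj \<sigma>"
    and "\<And>v. v \<in> A d \<Longrightarrow> T v \<in> A' e"
    and "\<And>v. v \<in> A d \<Longrightarrow> T v \<in> B' e \<longleftrightarrow> v \<in> B d"
    and "\<And>w. w \<in> A' e \<Longrightarrow> \<exists>v\<in>A d. w - T v \<in> B' e"
  shows "hilb A d - hilb B d = hilb A' e - hilb B' e"
  unfolding hilb_def
proof (rule mpoly.dim_diff_eq_if_semilinear_quotient_iso[where T = T and \<sigma> = \<sigma>])
  show "A d \<subseteq> mpoly.span (monom_basis X d)" "A' e \<subseteq> mpoly.span (monom_basis X e)"
    using graded_idealD(1)[OF assms(2), of d] graded_idealD(1)[OF assms(4), of e] forms_subset_span by blast+
qed (use assms in \<open>auto simp: subspace_graded_ideal finite_monoms smul_def\<close>)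

section \<open>The semilinear rotation of the variables\<close>

locale cyclic_action =
  fixes p :: nat and \<sigma> :: "'a::field \<Rightarrow> 'a"
  assumes prime_p: "prime p" and \<sigma>_hom: "comm_ring_hom \<sigma>" and \<sigma>_order: "(\<sigma> ^^ p) c = c"
begin

abbreviation X where "X \<equiv> {..<p}"

text \<open>Variables with index at least \<open>p\<close> are also sent into \<open>X\<close>, so
  \<tau> has order dividing \<open>p\<close> only on polynomials in \<open>X\<close>.\<close>

definition \<tau> :: "(nat, 'a) mpoly \<Rightarrow> (nat, 'a) mpoly" where
  "\<tau> = peval (\<lambda>c. Poly_Mapping.single 0 (\<sigma> c)) (\<lambda>j. var ((j + 1) mod p))"

text \<open>One inclusion suffices for invariance: the inverse of \<tau> on forms in
  \<open>X\<close> is a power of \<tau>, as exploited in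
  \<open>stable_ideal_funpow_iff\<close>.\<close>

definition stable_ideal :: "(nat \<Rightarrow> (nat, 'a) mpoly set) \<Rightarrow> bool" where
  "stable_ideal A \<longleftrightarrow> graded_ideal X A \<and> (\<forall>d. \<forall>f\<in>A d. \<tau> f \<in> A d)"

lemma p_pos: "0 < p" using prime_p by (rule prime_gt_0_nat)

lemma const_\<sigma>_hom: "comm_ring_hom (\<lambda>c. Poly_Mapping.single 0 (\<sigma> c) :: (nat, 'a) mpoly)"
proof -
  interpret comm_ring_hom \<sigma> by (rule \<sigma>_hom)
  show ?thesis by standard (auto simp: single_add mult_single hom_add hom_mult)
qed

lemma \<tau>_hom: "comm_ring_hom \<tau>"
  unfolding \<tau>_def by (rule peval_comm_ring_hom[OF const_\<sigma>_hom])

lemma \<tau>_const: "\<tau> (Poly_Mapping.single 0 c) = Poly_Mapping.single 0 (\<sigma> c)"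
  unfolding \<tau>_def by (rule peval_const[OF const_\<sigma>_hom])

lemma \<tau>_var: "\<tau> (var j) = var ((j + 1) mod p)"
  unfolding \<tau>_def by (rule peval_var[OF const_\<sigma>_hom])

lemma \<tau>_forms: "f \<in> forms X d \<Longrightarrow> \<tau> f \<in> forms X d"
  unfolding \<tau>_def by (erule peval_forms) (auto intro!: forms_const forms_var[unfolded One_nat_def] simp: p_pos)

lemma funpow_\<tau>_hom: "comm_ring_hom (\<tau> ^^ n)"
  by (rule comm_ring_hom_funpow[OF \<tau>_hom])

lemma funpow_\<tau>_const: "(\<tau> ^^ n) (Poly_Mapping.single 0 c) = Poly_Mapping.single 0 ((\<sigma> ^^ n) c)"
  by (induction n) (auto simp: \<tau>_const)

lemma funpow_\<tau>_var: "j < p \<Longrightarrow> (\<tau> ^^ n) (var j) = var ((j + n) mod p)"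
  by (induction n) (auto simp: \<tau>_var mod_Suc_eq)

lemma funpow_\<tau>_forms: "f \<in> forms X d \<Longrightarrow> (\<tau> ^^ n) f \<in> forms X d"
  by (induction n) (auto simp: \<tau>_forms)

lemma \<tau>_order:
  assumes "f \<in> forms X d"
  shows "(\<tau> ^^ p) f = f"
proof -
  have "(\<tau> ^^ p) f = (\<tau> ^^ p) (peval (Poly_Mapping.single 0) var f)" by (simp add: peval_id)
  also have "\<dots> = peval ((\<tau> ^^ p) \<circ> Poly_Mapping.single 0) ((\<tau> ^^ p) \<circ> var) f"
    by (rule comm_ring_hom_peval[OF funpow_\<tau>_hom])
  also have "\<dots> = peval (Poly_Mapping.single 0) var f"
    using assms forms_subset_polys_in
    by (intro peval_cong[of _ X]) (auto simp: funpow_\<tau>_const \<sigma>_order funpow_\<tau>_var)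
  finally show ?thesis by (simp add: peval_id)
qed

lemma stable_idealD:
  assumes "stable_ideal A"
  shows "graded_ideal X A" "f \<in> A d \<Longrightarrow> \<tau> f \<in> A d"
  using assms by (auto simp: stable_ideal_def)

lemma stable_ideal_funpow: "stable_ideal A \<Longrightarrow> f \<in> A d \<Longrightarrow> (\<tau> ^^ n) f \<in> A d"
  by (induction n) (auto simp: stable_idealD)

lemma stable_ideal_funpow_iff:
  assumes "stable_ideal A" "f \<in> forms X d" "n \<le> p"
  shows "(\<tau> ^^ n) f \<in> A d \<longleftrightarrow> f \<in> A d"
proof
  assume "(\<tau> ^^ n) f \<in> A d"
  then have "(\<tau> ^^ (p - n)) ((\<tau> ^^ n) f) \<in> A d" by (rule stable_ideal_funpow[OF assms(1)])
  moreover have "(\<tau> ^^ (p - n)) ((\<tau> ^^ n) f) = (\<tau> ^^ p) f"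
    using assms(3) by (metis comp_apply funpow_add le_add_diff_inverse2)
  ultimately show "f \<in> A d" using \<tau>_order[OF assms(2)] by simp
qed (rule stable_ideal_funpow[OF assms(1)])

lemma surj_funpow_\<sigma>: "surj (\<sigma> ^^ n)"
proof -
  have "(\<sigma> ^^ (p * m)) c = c" for m c
    by (induction m) (auto simp: funpow_add \<sigma>_order)
  \<comment> \<open>The exponent \<open>p * n - n\<close> complements \<open>n\<close> to a multiple
    of the order, which gives a right inverse.\<close>
  then have "(\<sigma> ^^ n) ((\<sigma> ^^ (p * n - n)) c) = c" for c
    using p_pos by (metis comp_apply funpow_add le_add_diff_inverse mult_le_mono1 mult_1 Suc_leI One_nat_def)
  then show ?thesis by (metis surjI)
qed

text \<open>The indices \<open>j\<close> for which the class of \<open>a\<close> modulo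
  \<open>B\<close> survives in the localisation at \<open>var j\<close>; \<open>d\<close> is the
  degree of \<open>a\<close>.\<close>

definition support :: "(nat \<Rightarrow> (nat, 'a) mpoly set) \<Rightarrow> nat \<Rightarrow> (nat, 'a) mpoly \<Rightarrow> nat set" where
  "support B d a = {j. j < p \<and> (\<forall>n. var j ^ n * a \<notin> B (n + d))}"

lemma finite_support [simp]: "finite (support B d a)"
  by (simp add: support_def)

lemma support_subset: "support B d a \<subseteq> {..<p}"
  by (auto simp: support_def)

lemma forms_var_power: "j < p \<Longrightarrow> var j ^ n \<in> forms X n"
  using forms_power[OF forms_var, of j X n] by simp

lemma var_power_kill_mono:
  assumes B: "graded_ideal X B" and "j < p" "var j ^ n * a \<in> B (n + d)" "n \<le> N"
  shows "var j ^ N * a \<in> B (N + d)"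
proof -
  have "var j ^ (N - n) * (var j ^ n * a) \<in> B ((N - n) + (n + d))"
    by (rule graded_idealD(4)[OF B forms_var_power[OF assms(2)] assms(3)])
  then show ?thesis using assms(4) by (simp flip: mult.assoc power_add)
qed

lemma support_mult:
  assumes B: "graded_ideal X B" and s: "s \<in> forms X e"
  shows "support B (e + d) (s * a) \<subseteq> support B d a"
proof
  fix j assume j: "j \<in> support B (e + d) (s * a)"
  have "var j ^ n * a \<notin> B (n + d)" for n
  proof
    assume "var j ^ n * a \<in> B (n + d)"
    then have "s * (var j ^ n * a) \<in> B (e + (n + d))" using graded_idealD(4)[OF B s] by blast
    then have "var j ^ n * (s * a) \<in> B (n + (e + d))" by (simp add: ac_simps)
    then show False using j by (simp add: support_def)
  qed
  then show "j \<in> support B d a" using j by (simp add: support_def)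
qed

text \<open>Applying \<tau> to a relation that kills \<open>a\<close> by a power of a variable gives
  one that kills \<open>\<tau> a\<close> by the same power of the next variable.\<close>

lemma support_\<tau>:
  assumes B: "stable_ideal B"
  shows "support B d (\<tau> a) \<subseteq> (\<lambda>j. (j + 1) mod p) ` support B d a"
proof
  interpret comm_ring_hom \<tau> by (rule \<tau>_hom)
  fix j assume j: "j \<in> support B d (\<tau> a)"
  \<comment> \<open>The cyclic predecessor of \<open>j\<close>, written without subtracting from a
    possibly zero \<open>j\<close>.\<close>
  define i where "i = (j + (p - 1)) mod p"
  have i: "i < p" "(i + 1) mod p = j"
    using j p_pos by (auto simp: i_def support_def mod_Suc_eq)
  have "var i ^ n * a \<notin> B (n + d)" for n
  proof
    assume "var i ^ n * a \<in> B (n + d)"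
    then have "\<tau> (var i ^ n * a) \<in> B (n + d)" by (rule stable_idealD(2)[OF B])
    then have "var j ^ n * \<tau> a \<in> B (n + d)" using i(2) by (simp add: hom_mult hom_power \<tau>_var)
    then show False using j by (simp add: support_def)
  qed
  then have "i \<in> support B d a" using i by (simp add: support_def)
  then show "j \<in> (\<lambda>j. (j + 1) mod p) ` support B d a" using i(2) by blast
qed

text \<open>As \<open>p\<close> is prime, \<open>c\<close> generates the integers modulo
  \<open>p\<close>, so shifting by \<open>c\<close> acts transitively on the indices.\<close>

lemma shift_invariant_trivial:
  assumes T: "T \<subseteq> {..<p}" and c: "0 < c" "c < p" and inv: "(\<lambda>j. (j + c) mod p) ` T = T"
  shows "T = {} \<or> T = {..<p}"
proof (rule disjCI)
  assume "T \<noteq> {..<p}"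
  show "T = {}"
  proof (rule ccontr)
    assume "T \<noteq> {}"
    then obtain j where j: "j \<in> T" by blast
    have it: "(j + n * c) mod p \<in> T" for n
    proof (induction n)
      case 0
      then show ?case using j T by auto
    next
      case (Suc n)
      then have "((j + n * c) mod p + c) mod p \<in> T" using inv by blast
      then show ?case by (simp add: mod_simps ac_simps)
    qed
    have "\<not> p dvd c" using c by (auto dest: dvd_imp_le)
    then have "coprime c p" using prime_p by (metis coprime_commute prime_imp_coprime)
    \<comment> \<open>With \<open>x\<close> inverse to \<open>c\<close>, making
      \<open>x * (j' + (p - j))\<close> shifts by \<open>c\<close> leads from \<open>j\<close> to
      \<open>j'\<close>.\<close>
    then obtain x where x: "[c * x = 1] (mod p)" using cong_solve_coprime_nat[of c p] by auto
    have "j' \<in> T" if "j' < p" for j'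
    proof -
      have "[j + (x * (j' + (p - j))) * c = j + 1 * (j' + (p - j))] (mod p)"
        using cong_add[OF cong_refl cong_mult[OF x cong_refl]] by (metis mult.assoc mult.commute)
      then have "(j + (x * (j' + (p - j))) * c) mod p = (j' + p) mod p"
        using j T by (auto simp: cong_def)
      then show ?thesis using it[of "x * (j' + (p - j))"] that by simp
    qed
    then show False using T \<open>T \<noteq> {..<p}\<close> by blast
  qed
qed

end

section \<open>Ideals stable under a cyclic action\<close>

context cyclic_action
begin

section \<open>The orbit of an element of minimal support\<close>

context
  fixes A B :: "nat \<Rightarrow> (nat, 'a) mpoly set" and d :: nat and a :: "(nat, 'a) mpoly"
  assumes A: "stable_ideal A" and B: "stable_ideal B" and B_le: "\<And>m. B m \<subseteq> A m"
    and a: "a \<in> A d" "a \<notin> B d"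
    and minimal: "\<And>e f. f \<in> A e \<Longrightarrow> f \<notin> B e \<Longrightarrow> card (support B d a) \<le> card (support B e f)"
begin

abbreviation orb :: "nat \<Rightarrow> (nat, 'a) mpoly" where "orb i \<equiv> (\<tau> ^^ i) a"

abbreviation supp :: "nat \<Rightarrow> nat set" where "supp i \<equiv> support B d (orb i)"

private lemmas idA = stable_idealD(1)[OF A]
private lemmas idB = stable_idealD(1)[OF B]

lemma a_forms: "a \<in> forms X d"
  using a(1) graded_idealD(1)[OF idA] by blast

lemma orb_mem: "orb i \<in> A d"
  using stable_ideal_funpow[OF A a(1)] .

lemma orb_notin: "i \<le> p \<Longrightarrow> orb i \<notin> B d"
  using stable_ideal_funpow_iff[OF B a_forms] a(2) by blast

lemma card_supp_Suc_le: "card (supp (Suc i)) \<le> card ((\<lambda>j. (j + 1) mod p) ` supp i)"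
  using support_\<tau>[OF B, of d "orb i"] by (intro card_mono) auto

text \<open>Applying \<tau> cannot enlarge the support, and minimality of the support of
  \<open>a\<close> forbids it to shrink, since \<open>orb i\<close> is again in \<open>A\<close> and
  outside \<open>B\<close>.\<close>

lemma card_supp: "i \<le> p \<Longrightarrow> card (supp i) = card (supp 0)"
proof (induction i)
  case (Suc i)
  have "card (supp (Suc i)) \<le> card (supp i)"
    using card_supp_Suc_le[of i] card_image_le[OF finite_support] by (rule order_trans)
  moreover have "card (supp 0) \<le> card (supp (Suc i))"
    using minimal[OF orb_mem orb_notin[OF Suc.prems]] by simp
  ultimately show ?case using Suc by simp
qed simp

lemma supp_Suc: "Suc i \<le> p \<Longrightarrow> supp (Suc i) = (\<lambda>j. (j + 1) mod p) ` supp i"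
proof (rule card_subset_eq)
  assume i: "Suc i \<le> p"
  show "supp (Suc i) \<subseteq> (\<lambda>j. (j + 1) mod p) ` supp i"
    using support_\<tau>[OF B, of d "orb i"] by simp
  have "card (supp (Suc i)) = card (supp i)" using card_supp[of i] card_supp[OF i] i by simp
  then show "card (supp (Suc i)) = card ((\<lambda>j. (j + 1) mod p) ` supp i)"
    using card_supp_Suc_le[of i] card_image_le[OF finite_support, of "\<lambda>j. (j + 1) mod p" B d "orb i"] by simp
qed simp

lemma supp_shift: "i + n \<le> p \<Longrightarrow> supp (i + n) = (\<lambda>j. (j + n) mod p) ` supp i"
proof (induction n)
  case 0
  have "(\<lambda>j. (j + 0) mod p) ` supp i = (\<lambda>j. j) ` supp i"
    using support_subset[of B d "orb i"] by (intro image_cong) auto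
  then show ?case by simp
next
  case (Suc n)
  then have "supp (i + Suc n) = (\<lambda>j. (j + 1) mod p) ` (\<lambda>j. (j + n) mod p) ` supp i"
    using supp_Suc[of "i + n"] by simp
  then show ?case by (simp add: image_image mod_Suc_eq)
qed

text \<open>A coincidence would make a set of indices invariant under a shift by
  \<open>k - i\<close>, hence empty or full, although its size is strictly between 0 and
  \<open>p\<close>.\<close>

lemma supp_distinct:
  assumes nontriv: "supp 0 \<noteq> {}" "supp 0 \<noteq> {..<p}" and ik: "i < k" "k < p"
  shows "supp i \<noteq> supp k"
proof
  assume eq: "supp i = supp k"
  have "(\<lambda>j. (j + (k - i)) mod p) ` supp i = supp i"
    using supp_shift[of i "k - i"] ik eq by simp
  then have "supp i = {} \<or> supp i = {..<p}"
    using shift_invariant_trivial[OF support_subset, of "k - i"] ik by simp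
  moreover have "card (supp i) = card (supp 0)" using card_supp ik by simp
  moreover have "card (supp 0) < card {..<p}"
    using nontriv(2) support_subset by (intro psubset_card_mono) auto
  moreover have "card (supp 0) \<noteq> 0" using nontriv(1) by simp
  ultimately show False by (elim disjE) simp_all
qed

text \<open>Passing to a multiple can only shrink the support, and minimality excludes this as long
  as the multiple is outside \<open>B\<close>.\<close>

lemma support_multiple:
  assumes "i \<le> p" "s \<in> forms X e" "s * orb i \<notin> B (e + d)"
  shows "support B (e + d) (s * orb i) = supp i"
proof (rule card_seteq)
  show "support B (e + d) (s * orb i) \<subseteq> supp i" by (rule support_mult[OF idB assms(2)])
  have "s * orb i \<in> A (e + d)" using graded_idealD(4)[OF idA assms(2) orb_mem] .
  then show "card (supp i) \<le> card (support B (e + d) (s * orb i))"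
    using minimal assms(3) card_supp[OF assms(1)] by simp
qed simp

text \<open>A power of a variable in the support never kills, and by \<open>support_multiple\<close>
  the support stays the same after each factor, so the factors can be multiplied on one by
  one.\<close>

lemma prod_var_power_mult_notin:
  assumes "i \<le> p" "s \<in> forms X e" "s * orb i \<notin> B (e + d)" "J \<subseteq> supp i"
  shows "(\<Prod>j\<in>J. var j ^ n :: (nat, 'a) mpoly) \<in> forms X (card J * n)
    \<and> (\<Prod>j\<in>J. var j ^ n) * s * orb i \<notin> B (card J * n + e + d)"
proof -
  have "finite J" using assms(4) by (rule finite_subset) simp
  then show ?thesis using assms(4)
  proof (induction J rule: finite_induct)
    case empty
    then show ?case using assms(3) by (simp add: forms_one)
  next
    case (insert j J)
    let ?P = "\<Prod>j\<in>J. var j ^ n :: (nat, 'a) mpoly"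
    have IH: "?P \<in> forms X (card J * n)" "?P * s * orb i \<notin> B (card J * n + e + d)"
      using insert by auto
    have "support B (card J * n + e + d) (?P * s * orb i) = supp i"
      using IH forms_mult[OF IH(1) assms(2)] by (intro support_multiple assms(1))
    then have j: "j \<in> support B (card J * n + e + d) (?P * s * orb i)" using insert by blast
    then have "j < p" by (simp add: support_def)
    have "var j ^ n * (?P * s * orb i) \<notin> B (n + (card J * n + e + d))"
      using j by (simp add: support_def)
    moreover have "var j ^ n * ?P \<in> forms X (n + card J * n)"
      by (rule forms_mult[OF forms_var_power[OF \<open>j < p\<close>] IH(1)])
    ultimately show ?case using insert.hyps by (simp add: ac_simps)
  qed
qed

text \<open>With full support the product of all variables could not send \<open>a\<close> into
  \<open>B\<close>.\<close>

lemma supp_neq_all: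
  assumes "\<And>m f. f \<in> A m \<Longrightarrow> (\<Prod>j<p. var j) * f \<in> B (p + m)"
  shows "supp 0 \<noteq> {..<p}"
proof
  assume "supp 0 = {..<p}"
  then have "(\<Prod>j<p. var j ^ 1) * 1 * orb 0 \<notin> B (card {..<p} * 1 + 0 + d)"
    using prod_var_power_mult_notin[of 0 1 0 "{..<p}" 1] a(2) forms_one by auto
  then show False using assms[OF a(1)] by simp
qed

text \<open>The coefficients with which an element of degree \<open>d\<close> lands in degree
  \<open>m\<close>. The case \<open>m < d\<close> is separated because \<open>m - d\<close> would be
  truncated to 0 there.\<close>

definition coef :: "nat \<Rightarrow> (nat, 'a) mpoly set" where
  "coef m = (if d \<le> m then forms X (m - d) else {0})"

lemma coef_zero [simp]: "0 \<in> coef m"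
  by (simp add: coef_def)

lemma coef_add: "s \<in> coef m \<Longrightarrow> t \<in> coef m \<Longrightarrow> s + t \<in> coef m"
  by (auto simp: coef_def forms_add split: if_splits)

lemma coef_mult: "h \<in> forms X e \<Longrightarrow> s \<in> coef m \<Longrightarrow> h * s \<in> coef (e + m)"
  using forms_mult[of h X e s "m - d"] by (auto simp: coef_def split: if_splits)

lemma coef_funpow_\<tau>: "s \<in> coef m \<Longrightarrow> (\<tau> ^^ n) s \<in> coef m"
proof -
  interpret comm_ring_hom "\<tau> ^^ n" by (rule funpow_\<tau>_hom)
  show "s \<in> coef m \<Longrightarrow> (\<tau> ^^ n) s \<in> coef m"
    by (auto simp: coef_def funpow_\<tau>_forms split: if_splits)
qed

lemma coef_\<tau>_order: "s \<in> coef m \<Longrightarrow> (\<tau> ^^ p) s = s"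
  using \<tau>_order forms_zero by (auto simp: coef_def split: if_splits)

lemma coef_mult_mem:
  assumes "graded_ideal X D" "f \<in> D d" "s \<in> coef m"
  shows "s * f \<in> D m"
  using assms graded_idealD(4)[OF assms(1), of s "m - d" f d] graded_idealD(2)[OF assms(1)]
  by (auto simp: coef_def split: if_splits)

text \<open>The ideal generated by \<open>B\<close> and the first \<open>k\<close> elements of the
  orbit; these ideals filter the step from \<open>B\<close> to the full orbit.\<close>

definition orbit_ideal :: "nat \<Rightarrow> nat \<Rightarrow> (nat, 'a) mpoly set" where
  "orbit_ideal k m = {b + (\<Sum>i<k. s i * orb i) | b s. b \<in> B m \<and> (\<forall>i. s i \<in> coef m)}"

lemma orbit_idealI: "b \<in> B m \<Longrightarrow> (\<And>i. s i \<in> coef m) \<Longrightarrow> b + (\<Sum>i<k. s i * orb i) \<in> orbit_ideal k m"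
  unfolding orbit_ideal_def by blast

lemma orbit_idealE:
  assumes "f \<in> orbit_ideal k m"
  obtains b s where "b \<in> B m" "\<And>i. s i \<in> coef m" "f = b + (\<Sum>i<k. s i * orb i)"
  using assms unfolding orbit_ideal_def by blast

lemma orbit_ideal_zero: "orbit_ideal 0 = B"
  unfolding orbit_ideal_def using coef_zero by (fastforce intro!: ext)

lemma orbit_ideal_le: "orbit_ideal k m \<subseteq> A m"
proof
  fix f assume "f \<in> orbit_ideal k m"
  then obtain b s where "b \<in> B m" "\<And>i. s i \<in> coef m" "f = b + (\<Sum>i<k. s i * orb i)"
    by (rule orbit_idealE) blast
  then show "f \<in> A m"
    using B_le by (auto intro!: graded_idealD(3)[OF idA] graded_ideal_sum[OF idA] coef_mult_mem[OF idA] orb_mem)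
qed

lemma B_le_orbit_ideal: "B m \<subseteq> orbit_ideal k m"
  using orbit_idealI[of _ m "\<lambda>_. 0" k] by auto

lemma graded_ideal_orbit_ideal: "graded_ideal X (orbit_ideal k)"
  unfolding graded_ideal_def
proof (intro conjI allI ballI)
  fix m
  show "orbit_ideal k m \<subseteq> forms X m" using orbit_ideal_le graded_idealD(1)[OF idA] by blast
  show "0 \<in> orbit_ideal k m" using B_le_orbit_ideal graded_idealD(2)[OF idB] by blast
  show "f + g \<in> orbit_ideal k m" if f: "f \<in> orbit_ideal k m" and g: "g \<in> orbit_ideal k m" for f g
  proof -
    obtain b s where s: "b \<in> B m" "\<And>i. s i \<in> coef m" "f = b + (\<Sum>i<k. s i * orb i)"
      using f by (rule orbit_idealE) blast
    obtain c t where t: "c \<in> B m" "\<And>i. t i \<in> coef m" "g = c + (\<Sum>i<k. t i * orb i)"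
      using g by (rule orbit_idealE) blast
    have "(b + c) + (\<Sum>i<k. (s i + t i) * orb i) \<in> orbit_ideal k m"
      using s t by (intro orbit_idealI graded_idealD(3)[OF idB] coef_add)
    then show ?thesis by (simp add: s(3) t(3) distrib_right sum.distrib ac_simps)
  qed
  show "h * f \<in> orbit_ideal k (e + m)" if h: "h \<in> forms X e" and f: "f \<in> orbit_ideal k m" for h f e
  proof -
    obtain b s where s: "b \<in> B m" "\<And>i. s i \<in> coef m" "f = b + (\<Sum>i<k. s i * orb i)"
      using f by (rule orbit_idealE) blast
    have "h * b + (\<Sum>i<k. (h * s i) * orb i) \<in> orbit_ideal k (e + m)"
      using s h by (intro orbit_idealI graded_idealD(4)[OF idB] coef_mult)
    then show ?thesis by (simp add: s(3) distrib_left sum_distrib_left mult.assoc)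
  qed
qed

lemma orb_mult_mem_orbit_ideal:
  assumes "i < k" "s \<in> coef m"
  shows "s * orb i \<in> orbit_ideal k m"
proof -
  have "0 + (\<Sum>j<k. (if j = i then s else 0) * orb j) \<in> orbit_ideal k m"
    using assms graded_idealD(2)[OF idB] by (intro orbit_idealI) auto
  moreover have "(\<Sum>j<k. (if j = i then s else 0) * orb j) = (\<Sum>j<k. if j = i then s * orb j else 0)"
    by (intro sum.cong) auto
  ultimately show ?thesis using assms(1) by simp
qed

text \<open>\<tau> moves each \<open>orb i\<close> to the next one, and the last one returns to
  \<open>a\<close> because \<tau> has order dividing \<open>p\<close> on forms.\<close>

lemma stable_orbit_ideal: "stable_ideal (orbit_ideal p)"
  unfolding stable_ideal_def
proof (intro conjI allI ballI graded_ideal_orbit_ideal)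
  interpret comm_ring_hom \<tau> by (rule \<tau>_hom)
  fix m f assume "f \<in> orbit_ideal p m"
  then obtain b s where s: "b \<in> B m" "\<And>i. s i \<in> coef m" "f = b + (\<Sum>i<p. s i * orb i)"
    by (rule orbit_idealE) blast
  have s1: "\<tau> (s i) \<in> coef m" for i using coef_funpow_\<tau>[OF s(2), of 1 i] by simp
  have "\<tau> (s i) * orb (Suc i) \<in> orbit_ideal p m" if "i < p" for i
  proof (cases "Suc i = p")
    case True
    then show ?thesis using orb_mult_mem_orbit_ideal[OF p_pos s1] \<tau>_order[OF a_forms] by auto
  next
    case False
    then show ?thesis using that by (intro orb_mult_mem_orbit_ideal s1) simp
  qed
  then have "\<tau> b + (\<Sum>i<p. \<tau> (s i) * orb (Suc i)) \<in> orbit_ideal p m"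
    using stable_idealD(2)[OF B s(1)] B_le_orbit_ideal
    by (intro graded_idealD(3)[OF graded_ideal_orbit_ideal] graded_ideal_sum[OF graded_ideal_orbit_ideal]) auto
  then show "\<tau> f \<in> orbit_ideal p m" by (simp add: s(3) hom_add hom_sum hom_mult)
qed

text \<open>
  The supports of the \<open>orb i\<close> have the same size and are distinct, so each contains a variable
  outside any other: a product of powers of the variables in \<open>supp k\<close> kills \<open>orb i\<close> for \<open>i < k\<close>,
  but no multiple of \<open>orb k\<close> outside \<open>B\<close>. Hence the orbit spans a direct sum modulo \<open>B\<close>.
\<close>

lemma orb_mult_mem_B:
  assumes nontriv: "supp 0 \<noteq> {}" "supp 0 \<noteq> {..<p}"
    and k: "k < p" and s: "s \<in> coef m" and mem: "s * orb k \<in> orbit_ideal k m"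
  shows "s * orb k \<in> B m"
proof (cases "d \<le> m")
  case False
  then show ?thesis using s graded_idealD(2)[OF idB] by (simp add: coef_def)
next
  case True
  define e where "e = m - d"
  have m: "m = e + d" and se: "s \<in> forms X e" using True s by (auto simp: e_def coef_def)
  show ?thesis
  proof (rule ccontr)
    assume notin: "s * orb k \<notin> B m"
    have "\<exists>j n. j \<in> supp k \<and> var j ^ n * orb i \<in> B (n + d)" if "i < k" for i
    proof -
      have "supp k \<noteq> supp i" using supp_distinct[OF nontriv that k] by simp
      moreover have "card (supp k) = card (supp i)" using card_supp that k by simp
      ultimately have "\<not> supp k \<subseteq> supp i" using card_subset_eq[of "supp i" "supp k"] by auto
      then obtain j where "j \<in> supp k" "j \<notin> supp i" by blast
      then show ?thesis by (auto simp: support_def)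
    qed
    then obtain j n where jn: "\<And>i. i < k \<Longrightarrow> j i \<in> supp k" "\<And>i. i < k \<Longrightarrow> var (j i) ^ n i * orb i \<in> B (n i + d)"
      by metis
    \<comment> \<open>The sum bounds every \<open>n i\<close>, so that a single exponent serves for
      all \<open>i < k\<close>.\<close>
    define N where "N = (\<Sum>i<k. n i)"
    let ?P = "\<Prod>j\<in>supp k. var j ^ N :: (nat, 'a) mpoly"
    define q where "q = card (supp k) * N"
    have P: "?P \<in> forms X q" "?P * s * orb k \<notin> B (q + e + d)"
      using prod_var_power_mult_notin[of k s e "supp k" N] k se notin by (auto simp: m q_def)
    have kill: "?P * (t * orb i) \<in> B (q + e + d)" if i: "i < k" and t: "t \<in> forms X e" for i t
    proof -
      have ji: "j i < p" using jn(1)[OF i] by (simp add: support_def)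
      have "n i \<le> N" unfolding N_def using i by (intro member_le_sum) auto
      then have "var (j i) ^ N * orb i \<in> B (N + d)"
        using var_power_kill_mono[OF idB ji jn(2)[OF i]] by blast
      moreover have "(\<Prod>l\<in>supp k - {j i}. var l ^ N :: (nat, 'a) mpoly) \<in> forms X (\<Sum>l\<in>supp k - {j i}. N)"
        by (intro forms_prod forms_var_power) (auto simp: support_def)
      ultimately have "((\<Prod>l\<in>supp k - {j i}. var l ^ N) * t) * (var (j i) ^ N * orb i)
          \<in> B ((card (supp k - {j i}) * N + e) + (N + d))"
        using graded_idealD(4)[OF idB forms_mult[OF _ t]] by simp
      moreover have "?P = var (j i) ^ N * (\<Prod>l\<in>supp k - {j i}. var l ^ N)"
        using jn(1)[OF i] by (intro prod.remove) auto
      moreover have "card (supp k) = Suc (card (supp k - {j i}))"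
        using card.remove[OF finite_support jn(1)[OF i]] .
      ultimately show ?thesis by (simp add: q_def ac_simps)
    qed
    \<comment> \<open>Multiplying this relation by the product of powers puts its right side into
      \<open>B\<close>, while its left side stays outside.\<close>
    obtain b t where t: "b \<in> B m" "\<And>i. t i \<in> coef m" "s * orb k = b + (\<Sum>i<k. t i * orb i)"
      using mem by (rule orbit_idealE) blast
    have te: "t i \<in> forms X e" for i using t(2)[of i] True by (simp add: coef_def e_def)
    have "?P * b \<in> B (q + m)" by (rule graded_idealD(4)[OF idB P(1) t(1)])
    then have "?P * b + (\<Sum>i<k. ?P * (t i * orb i)) \<in> B (q + e + d)"
      using kill te by (intro graded_idealD(3)[OF idB] graded_ideal_sum[OF idB]) (auto simp: m add.assoc)
    then have "?P * (s * orb k) \<in> B (q + e + d)"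
      unfolding t(3) by (simp add: distrib_left sum_distrib_left)
    then show False using P(2) by (simp add: mult.assoc)
  qed
qed

text \<open>\<open>\<tau> ^^ k\<close> induces a semilinear isomorphism from the first layer of the
  filtration to the layer generated by \<open>orb k\<close>. It is injective because the orbit spans
  a direct sum modulo \<open>B\<close>.\<close>

lemma hilb_orbit_ideal_Suc:
  assumes nontriv: "supp 0 \<noteq> {}" "supp 0 \<noteq> {..<p}" and k: "k < p"
  shows "hilb (orbit_ideal (Suc k)) m - hilb (orbit_ideal k) m = hilb (orbit_ideal 1) m - hilb B m"
proof (rule sym, rule hilb_diff_eq_if_semilinear[where X = X and T = "\<tau> ^^ k" and \<sigma> = "\<sigma> ^^ k"])
  interpret comm_ring_hom "\<tau> ^^ k" by (rule funpow_\<tau>_hom)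
  show "orbit_ideal k m \<subseteq> orbit_ideal (Suc k) m"
  proof
    fix f assume "f \<in> orbit_ideal k m"
    then obtain b s where s: "b \<in> B m" "\<And>i. s i \<in> coef m" "f = b + (\<Sum>i<k. s i * orb i)"
      by (rule orbit_idealE) blast
    then have "b + (\<Sum>i<Suc k. (if i < k then s i else 0) * orb i) \<in> orbit_ideal (Suc k) m"
      by (intro orbit_idealI) auto
    then show "f \<in> orbit_ideal (Suc k) m" by (simp add: s(3))
  qed
  show "(\<tau> ^^ k) (u + v) = (\<tau> ^^ k) u + (\<tau> ^^ k) v" for u v by (rule hom_add)
  show "(\<tau> ^^ k) (Poly_Mapping.single 0 c * v) = Poly_Mapping.single 0 ((\<sigma> ^^ k) c) * (\<tau> ^^ k) v" for c v
    by (simp add: hom_mult funpow_\<tau>_const)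
  have image: "\<exists>b s. b \<in> B m \<and> s \<in> coef m \<and> v = b + s * a \<and> (\<tau> ^^ k) b \<in> B m \<and> (\<tau> ^^ k) s \<in> coef m
      \<and> (\<tau> ^^ k) v = (\<tau> ^^ k) b + (\<tau> ^^ k) s * orb k" if "v \<in> orbit_ideal 1 m" for v
  proof -
    obtain b s where s: "b \<in> B m" "\<And>i. s i \<in> coef m" "v = b + (\<Sum>i<1. s i * orb i)"
      using \<open>v \<in> orbit_ideal 1 m\<close> by (rule orbit_idealE) blast
    then have v: "v = b + s 0 * a" by simp
    show ?thesis
    proof (intro exI conjI)
      show "(\<tau> ^^ k) v = (\<tau> ^^ k) b + (\<tau> ^^ k) (s 0) * orb k" unfolding v hom_add hom_mult ..
    qed (rule v s stable_ideal_funpow[OF B s(1)] coef_funpow_\<tau>[OF s(2)])+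
  qed
  show "(\<tau> ^^ k) v \<in> orbit_ideal (Suc k) m" if "v \<in> orbit_ideal 1 m" for v
    using image[OF that] B_le_orbit_ideal[of m "Suc k"] graded_idealD(3)[OF graded_ideal_orbit_ideal, of _ "Suc k" m]
      orb_mult_mem_orbit_ideal[of k "Suc k"] by (metis lessI subsetD)
  show "(\<tau> ^^ k) v \<in> orbit_ideal k m \<longleftrightarrow> v \<in> B m" if v: "v \<in> orbit_ideal 1 m" for v
  proof
    assume mem: "(\<tau> ^^ k) v \<in> orbit_ideal k m"
    obtain b s where s: "(\<tau> ^^ k) b \<in> B m" "(\<tau> ^^ k) s \<in> coef m" "(\<tau> ^^ k) v = (\<tau> ^^ k) b + (\<tau> ^^ k) s * orb k"
      using image[OF v] by blast
    have "(\<tau> ^^ k) v - (\<tau> ^^ k) b \<in> orbit_ideal k m"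
      using mem s(1) B_le_orbit_ideal by (intro graded_ideal_diff[OF graded_ideal_orbit_ideal]) auto
    then have "(\<tau> ^^ k) s * orb k \<in> orbit_ideal k m" by (simp add: s(3))
    then have "(\<tau> ^^ k) s * orb k \<in> B m" by (rule orb_mult_mem_B[OF nontriv k s(2)])
    then have "(\<tau> ^^ k) v \<in> B m" unfolding s(3) by (intro graded_idealD(3)[OF idB] s(1))
    moreover have "v \<in> forms X m" using v graded_idealD(1)[OF graded_ideal_orbit_ideal] by blast
    ultimately show "v \<in> B m" using stable_ideal_funpow_iff[OF B, of v m k] k by simp
  next
    assume "v \<in> B m"
    then show "(\<tau> ^^ k) v \<in> orbit_ideal k m" using stable_ideal_funpow[OF B] B_le_orbit_ideal by blast
  qed
  show "\<exists>v\<in>orbit_ideal 1 m. w - (\<tau> ^^ k) v \<in> orbit_ideal k m" if w: "w \<in> orbit_ideal (Suc k) m" for w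
  proof -
    obtain b s where s: "b \<in> B m" "\<And>i. s i \<in> coef m" "w = b + (\<Sum>i<Suc k. s i * orb i)"
      using w by (rule orbit_idealE) blast
    \<comment> \<open>The twist by \<open>p - k\<close> is undone by \<open>\<tau> ^^ k\<close>, so
      that the image of this element is exactly the last summand of \<open>w\<close>.\<close>
    let ?v = "(\<tau> ^^ (p - k)) (s k) * orb 0"
    have "(\<tau> ^^ k) ((\<tau> ^^ (p - k)) (s k)) = s k"
      using coef_\<tau>_order[OF s(2)] k by (metis comp_apply funpow_add le_add_diff_inverse less_imp_le)
    then have "w - (\<tau> ^^ k) ?v = b + (\<Sum>i<k. s i * orb i)" by (simp add: s(3) hom_mult)
    then have "w - (\<tau> ^^ k) ?v \<in> orbit_ideal k m" using orbit_idealI[OF s(1,2)] by simp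
    moreover have "?v \<in> orbit_ideal 1 m" by (intro orb_mult_mem_orbit_ideal coef_funpow_\<tau> s(2)) simp
    ultimately show ?thesis by blast
  qed
qed (use graded_ideal_orbit_ideal idB B_le_orbit_ideal surj_funpow_\<sigma> in auto)

text \<open>The \<open>p\<close> layers of the filtration all have the same dimension.\<close>

lemma hilb_orbit_ideal_dvd:
  assumes "supp 0 \<noteq> {}" "supp 0 \<noteq> {..<p}"
  shows "int p dvd hilb (orbit_ideal p) m - hilb B m"
proof -
  have "k \<le> p \<Longrightarrow> hilb (orbit_ideal k) m - hilb B m = int k * (hilb (orbit_ideal 1) m - hilb B m)" for k
  proof (induction k)
    case (Suc k)
    then show ?case using hilb_orbit_ideal_Suc[OF assms, of k m] by (simp add: algebra_simps)
  qed (simp add: orbit_ideal_zero)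
  from this[of p] show ?thesis by simp
qed

text \<open>With empty support every \<open>orb i\<close> is killed by a power of every variable,
  hence by all forms of large degree.\<close>

lemma orbit_ideal_eventually_B:
  assumes "supp 0 = {}"
  shows "\<exists>M. \<forall>m\<ge>M. orbit_ideal p m = B m"
proof -
  have "\<exists>n. var j ^ n * orb i \<in> B (n + d)" if "i < p" "j < p" for i j
  proof -
    have "supp i = {}" using card_supp[of i] assms that by simp
    then show ?thesis using that by (auto simp: support_def)
  qed
  then obtain n where n: "\<And>i j. i < p \<Longrightarrow> j < p \<Longrightarrow> var j ^ n i j * orb i \<in> B (n i j + d)" by metis
  define N where "N = (\<Sum>i<p. \<Sum>j<p. n i j)"
  have N: "var j ^ N * orb i \<in> B (N + d)" if "i < p" "j < p" for i j
  proof (rule var_power_kill_mono[OF idB that(2) n[OF that]])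
    have "n i j \<le> (\<Sum>j<p. n i j)" using that by (intro member_le_sum) auto
    also have "\<dots> \<le> N" unfolding N_def using that by (intro member_le_sum[of i _ "\<lambda>i. \<Sum>j<p. n i j"]) auto
    finally show "n i j \<le> N" .
  qed
  have mono: "Poly_Mapping.single k 1 * orb i \<in> B (e + d)"
    if i: "i < p" and k: "k \<in> monoms X e" and e: "p * N < e" for i k e
  proof -
    \<comment> \<open>Pigeonhole: a monomial in \<open>p\<close> variables of degree above
      \<open>p * N\<close> contains some variable at least \<open>N\<close> times.\<close>
    have "\<exists>j<p. N \<le> Poly_Mapping.lookup k j"
    proof (rule ccontr)
      assume "\<not> ?thesis"
      then have "(\<Sum>j<p. Poly_Mapping.lookup k j) \<le> (\<Sum>j<p. N)" by (intro sum_mono) (auto simp: not_le)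
      moreover have "(\<Sum>j<p. Poly_Mapping.lookup k j) = e"
        using k by (auto simp: monoms_def monom_degree_superset[of "{..<p}"])
      ultimately show False using e by simp
    qed
    then obtain j where j: "j < p" "N \<le> Poly_Mapping.lookup k j" by blast
    define l where "l = k - Poly_Mapping.single j N"
    have kl: "k = l + Poly_Mapping.single j N"
      by (rule poly_mapping_eqI) (use j in \<open>auto simp: l_def lookup_add lookup_minus lookup_single when_def\<close>)
    have "l \<in> monoms X (e - N)" "N \<le> e"
      using k by (auto simp: kl monoms_def keys_add_nat monom_degree_add)
    then have "Poly_Mapping.single l 1 * (var j ^ N * orb i) \<in> B ((e - N) + (N + d))"
      by (intro graded_idealD(4)[OF idB _ N[OF i j(1)]] forms_single)
    moreover have "var j ^ N = (Poly_Mapping.single (Poly_Mapping.single j N) 1 :: (nat, 'a) mpoly)"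
      using mval_var[of "Poly_Mapping.single j N"] by (metis mval_single)
    ultimately show ?thesis using \<open>N \<le> e\<close> by (simp add: kl mult_single flip: mult.assoc)
  qed
  have gen: "s * orb i \<in> B m" if i: "i < p" and s: "s \<in> coef m" and m: "p * N + d < m" for i s m
  proof -
    have s: "s \<in> forms X (m - d)" using s m by (simp add: coef_def)
    have "(\<Sum>k\<in>Poly_Mapping.keys s. Poly_Mapping.single 0 (Poly_Mapping.lookup s k) * (Poly_Mapping.single k 1 * orb i)) \<in> B (m - d + d)"
      using s m by (intro graded_ideal_sum[OF idB] graded_ideal_scale[OF idB] mono i) (auto simp: forms_def)
    moreover have "(\<Sum>k\<in>Poly_Mapping.keys s. Poly_Mapping.single 0 (Poly_Mapping.lookup s k) * (Poly_Mapping.single k 1 * orb i)) = s * orb i"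
      by (simp add: mult_single poly_mapping_sum_single[symmetric] flip: mult.assoc sum_distrib_right)
    ultimately show ?thesis using m by simp
  qed
  have "orbit_ideal p m = B m" if "Suc (p * N + d) \<le> m" for m
  proof
    show "orbit_ideal p m \<subseteq> B m"
    proof
      fix f assume "f \<in> orbit_ideal p m"
      then obtain b s where s: "b \<in> B m" "\<And>i. s i \<in> coef m" "f = b + (\<Sum>i<p. s i * orb i)"
        by (rule orbit_idealE) blast
      then show "f \<in> B m"
        using gen that by (auto intro!: graded_idealD(3)[OF idB] graded_ideal_sum[OF idB])
    qed
  qed (rule B_le_orbit_ideal)
  then show ?thesis by blast
qed

lemma orbit_ideal_neq_B: "orbit_ideal p \<noteq> B"
proof
  assume "orbit_ideal p = B"
  moreover have "1 * orb 0 \<in> orbit_ideal p d"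
    by (intro orb_mult_mem_orbit_ideal p_pos) (simp add: coef_def forms_one)
  ultimately show False using a(2) by simp
qed

end

text \<open>\<open>D\<close> is generated over \<open>B\<close> by the orbit of an element of
  minimal support. If that support is empty, \<open>D\<close> and \<open>B\<close> agree in large
  degrees; otherwise it is a proper set of variables and the dimension differs by a multiple of
  \<open>p\<close> in every degree.\<close>

lemma exists_intermediate_ideal:
  assumes "stable_ideal A" "stable_ideal B" "\<And>m. B m \<subseteq> A m" "A \<noteq> B"
    and "\<And>m f. f \<in> A m \<Longrightarrow> (\<Prod>j<p. var j) * f \<in> B (p + m)"
  obtains D where "stable_ideal D" "\<And>m. B m \<subseteq> D m" "\<And>m. D m \<subseteq> A m" "D \<noteq> B"
    "\<exists>M. \<forall>m\<ge>M. int p dvd hilb D m - hilb B m"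
proof -
  have "\<exists>m f. f \<in> A m \<and> f \<notin> B m" using assms(3,4) by fastforce
  \<comment> \<open>Degree and element are packed into one pair, so that the minimum of the support
    size is taken over all degrees at once.\<close>
  then have "\<exists>z. snd z \<in> A (fst z) \<and> snd z \<notin> B (fst z)" by simp
  then obtain z where z: "snd z \<in> A (fst z) \<and> snd z \<notin> B (fst z)"
    "\<And>y. snd y \<in> A (fst y) \<and> snd y \<notin> B (fst y) \<Longrightarrow>
      card (support B (fst z) (snd z)) \<le> card (support B (fst y) (snd y))"
    using ex_has_least_nat[of "\<lambda>z. snd z \<in> A (fst z) \<and> snd z \<notin> B (fst z)" _
      "\<lambda>z. card (support B (fst z) (snd z))"] by blast
  define d where "d = fst z"
  define a where "a = snd z"
  have a: "a \<in> A d" "a \<notin> B d" using z(1) by (auto simp: d_def a_def)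
  have min: "card (support B d a) \<le> card (support B e f)" if "f \<in> A e" "f \<notin> B e" for e f
    using z(2)[of "(e, f)"] that by (simp add: d_def a_def)
  note ctx = assms(1,2,3) a min
  let ?C = "orbit_ideal B d a p"
  have "\<exists>M. \<forall>m\<ge>M. int p dvd hilb ?C m - hilb B m"
  proof (cases "support B d a = {}")
    case True
    then obtain M where "\<And>m. M \<le> m \<Longrightarrow> ?C m = B m" using orbit_ideal_eventually_B[OF ctx] by auto
    then show ?thesis by (intro exI[of _ M]) (simp add: hilb_def)
  next
    case False
    then show ?thesis using hilb_orbit_ideal_dvd[OF ctx] supp_neq_all[OF ctx] assms(5) by simp
  qed
  then show ?thesis
    using that stable_orbit_ideal[OF ctx] B_le_orbit_ideal[OF ctx] orbit_ideal_le[OF ctx] orbit_ideal_neq_B[OF ctx] by blast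
qed

text \<open>Noetherian induction from above: \<open>B\<close> is enlarged by intermediate ideals
  until it reaches \<open>A\<close>, and the divisible differences add up.\<close>

theorem hilb_dvd_if_prod_var_kills:
  assumes "stable_ideal A" "stable_ideal B" "\<And>m. B m \<subseteq> A m"
    and "\<And>m f. f \<in> A m \<Longrightarrow> (\<Prod>j<p. var j) * f \<in> B (p + m)"
  shows "\<exists>M. \<forall>m\<ge>M. int p dvd hilb A m - hilb B m"
proof -
  \<comment> \<open>Larger ideals count as smaller in \<open>R\<close>, so well-foundedness is the
    ascending chain condition.\<close>
  define R where "R = {(D, B). stable_ideal D \<and> stable_ideal B \<and> (\<forall>m. B m \<subseteq> D m) \<and> D \<noteq> B}"
  have "wf R"
    unfolding wf_iff_no_infinite_down_chain
  proof
    assume "\<exists>f. \<forall>i. (f (Suc i), f i) \<in> R"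
    then obtain f where f: "\<And>i. (f (Suc i), f i) \<in> R" by blast
    then have "\<exists>i. f (Suc i) = f i"
      by (intro graded_ideal_noetherian[of X]) (auto simp: R_def stable_ideal_def)
    then show False using f by (auto simp: R_def)
  qed
  then show ?thesis using assms(2-4)
  proof (induction B rule: wf_induct_rule)
    case (less B)
    show ?case
    proof (cases "A = B")
      case False
      obtain D where D: "stable_ideal D" "\<And>m. B m \<subseteq> D m" "\<And>m. D m \<subseteq> A m" "D \<noteq> B"
        "\<exists>M. \<forall>m\<ge>M. int p dvd hilb D m - hilb B m"
        using exists_intermediate_ideal[OF assms(1) less.prems(1,2) False less.prems(3)] by blast
      have "\<exists>M. \<forall>m\<ge>M. int p dvd hilb A m - hilb D m"
      proof (rule less.IH)
        show "(\<Prod>j<p. var j) * f \<in> D (p + m)" if "f \<in> A m" for m f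
          using less.prems(3)[OF that] D(2) by blast
      qed (use D less.prems in \<open>auto simp: R_def\<close>)
      then obtain M where M: "\<And>m. M \<le> m \<Longrightarrow> int p dvd hilb A m - hilb D m" by blast
      obtain M' where M': "\<And>m. M' \<le> m \<Longrightarrow> int p dvd hilb D m - hilb B m" using D(5) by blast
      have "int p dvd hilb A m - hilb B m" if "max M M' \<le> m" for m
        using dvd_add[OF M[of m] M'[of m]] that by simp
      then show ?thesis by blast
    qed simp
  qed
qed

end

section \<open>Differences of Hilbert functions\<close>

text \<open>For a nonzerodivisor of degree \<open>a\<close> on a graded module with Hilbert function
  \<open>f\<close>, this is the Hilbert function of the quotient in degree
  \<open>m + a\<close>.\<close>

definition fdiff :: "nat \<Rightarrow> (nat \<Rightarrow> int) \<Rightarrow> nat \<Rightarrow> int" where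
  "fdiff a f m = f (m + a) - f m"

lemma fold_fdiff_diff:
  "fold fdiff as (\<lambda>m. f m - g m) = (\<lambda>m. fold fdiff as f m - fold fdiff as g m)"
proof (induction as arbitrary: f g)
  case (Cons a as)
  have "fdiff a (\<lambda>m. f m - g m) = (\<lambda>m. fdiff a f m - fdiff a g m)"
    by (auto simp: fdiff_def)
  then show ?case using Cons by simp
qed simp

lemma fold_fdiff_sum:
  "fold fdiff as (\<lambda>m. \<Sum>i\<in>I. f i m) = (\<lambda>m. \<Sum>i\<in>I. fold fdiff as (f i) m)"
proof (induction as arbitrary: f)
  case (Cons a as)
  have "fdiff a (\<lambda>m. \<Sum>i\<in>I. f i m) = (\<lambda>m. \<Sum>i\<in>I. fdiff a (f i) m)"
    by (auto simp: fdiff_def sum_subtractf)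
  then show ?case using Cons[of "\<lambda>i. fdiff a (f i)"] by simp
qed simp

lemma fold_fdiff_shift: "fold fdiff as (\<lambda>m. f (m + a)) = (\<lambda>m. fold fdiff as f (m + a))"
proof (induction as arbitrary: f)
  case (Cons b as)
  have "fdiff b (\<lambda>m. f (m + a)) = (\<lambda>m. fdiff b f (m + a))"
    by (auto simp: fdiff_def ac_simps)
  then show ?case using Cons[of "fdiff b f"] by simp
qed simp

text \<open>By Pascal's rule a difference with step \<open>a\<close> turns the binomial into a sum
  of \<open>a\<close> binomials of lower index \<open>length as\<close> minus one. These differ by
  shifts of the argument, so \<open>c\<close> is kept arbitrary in the induction.\<close>

lemma fold_fdiff_binomial:
  "fold fdiff as (\<lambda>m. int ((m + c + length as) choose length as)) = (\<lambda>m. int (prod_list as))"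
proof (induction as arbitrary: c)
  case (Cons a as)
  let ?n = "length as"
  have "fdiff a (\<lambda>m. int ((m + c + Suc ?n) choose Suc ?n))
      = (\<lambda>m. \<Sum>i<a. int ((m + (c + i + 1) + ?n) choose ?n))"
  proof
    fix m
    show "fdiff a (\<lambda>m. int ((m + c + Suc ?n) choose Suc ?n)) m
        = (\<Sum>i<a. int ((m + (c + i + 1) + ?n) choose ?n))"
      by (induction a) (auto simp: fdiff_def ac_simps)
  qed
  then have "fold fdiff (a # as) (\<lambda>m. int ((m + c + Suc ?n) choose Suc ?n))
      = fold fdiff as (\<lambda>m. \<Sum>i<a. int ((m + (c + i + 1) + ?n) choose ?n))"
    by (simp only: fold.simps comp_apply)
  also have "\<dots> = (\<lambda>m. \<Sum>i<a. int (prod_list as))"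
    by (simp only: fold_fdiff_sum Cons)
  finally show ?case
    by (simp only: list.size add_Suc_right add_0_right sum_constant card_lessThan prod_list.Cons of_nat_mult)
qed simp

section \<open>Cokernel and kernel of multiplication by an invariant form\<close>

context cyclic_action
begin

context
  fixes A B :: "nat \<Rightarrow> (nat, 'a) mpoly set" and g :: "(nat, 'a) mpoly" and a :: nat
  assumes A: "stable_ideal A" and B: "stable_ideal B" and B_le: "\<And>m. B m \<subseteq> A m"
    and g: "g \<in> forms X a" "\<tau> g = g"
begin

text \<open>\<open>B + g A\<close>, so that \<open>A\<close>/\<open>adjoin\<close> is the cokernel
  of \<open>g\<close> on \<open>A\<close>/\<open>B\<close>. Below degree \<open>a\<close> only
  multiples of 0 are added, again because of truncated subtraction.\<close>

definition adjoin :: "nat \<Rightarrow> (nat, 'a) mpoly set" where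
  "adjoin m = {b + g * f | b f. b \<in> B m \<and> f \<in> (if a \<le> m then A (m - a) else {0})}"

text \<open>\<open>colon\<close>/\<open>B\<close> is the kernel of \<open>g\<close> on
  \<open>A\<close>/\<open>B\<close>.\<close>

definition colon :: "nat \<Rightarrow> (nat, 'a) mpoly set" where
  "colon m = {f \<in> A m. g * f \<in> B (a + m)}"

private lemmas gA = stable_idealD(1)[OF A]
private lemmas gB = stable_idealD(1)[OF B]

lemma adjoin_le: "adjoin m \<subseteq> A m"
proof
  fix f assume "f \<in> adjoin m"
  then obtain b h where f: "f = b + g * h" "b \<in> B m" "h \<in> (if a \<le> m then A (m - a) else {0})"
    unfolding adjoin_def by blast
  have "g * h \<in> A m"
    using f(3) graded_idealD(4)[OF gA g(1), of h "m - a"] graded_idealD(2)[OF gA]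
    by (auto split: if_splits)
  then show "f \<in> A m" unfolding f(1) using f(2) B_le by (intro graded_idealD(3)[OF gA]) auto
qed

lemma le_adjoin: "B m \<subseteq> adjoin m"
proof
  fix b assume "b \<in> B m"
  moreover have "b = b + g * 0" by simp
  moreover have "0 \<in> (if a \<le> m then A (m - a) else {0})" using graded_idealD(2)[OF gA] by simp
  ultimately show "b \<in> adjoin m" unfolding adjoin_def by blast
qed

lemma mult_mem_adjoin: "f \<in> A m \<Longrightarrow> g * f \<in> adjoin (a + m)"
proof -
  assume "f \<in> A m"
  then have "f \<in> (if a \<le> a + m then A (a + m - a) else {0})" by simp
  moreover have "0 \<in> B (a + m)" by (rule graded_idealD(2)[OF gB])
  moreover have "g * f = 0 + g * f" by simp
  ultimately show ?thesis unfolding adjoin_def by blast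
qed

lemma stable_adjoin: "stable_ideal adjoin"
  unfolding stable_ideal_def graded_ideal_def
proof (intro conjI allI ballI)
  interpret comm_ring_hom \<tau> by (rule \<tau>_hom)
  fix m e
  show "adjoin m \<subseteq> forms X m" using adjoin_le graded_idealD(1)[OF gA] by blast
  show "0 \<in> adjoin m" using le_adjoin graded_idealD(2)[OF gB] by blast
  let ?A = "if a \<le> m then A (m - a) else {0}"
  have mem: "b + g * f \<in> adjoin m" if "b \<in> B m" "f \<in> (if a \<le> m then A (m - a) else {0})" for b f m
    using that unfolding adjoin_def by blast
  show "f1 + f2 \<in> adjoin m" if f1: "f1 \<in> adjoin m" and f2: "f2 \<in> adjoin m" for f1 f2
  proof -
    obtain b1 h1 where 1: "f1 = b1 + g * h1" "b1 \<in> B m" "h1 \<in> ?A"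
      using f1 unfolding adjoin_def by blast
    obtain b2 h2 where 2: "f2 = b2 + g * h2" "b2 \<in> B m" "h2 \<in> ?A"
      using f2 unfolding adjoin_def by blast
    have "h1 + h2 \<in> ?A" using 1(3) 2(3) graded_idealD(3)[OF gA] by (auto split: if_splits)
    then have "(b1 + b2) + g * (h1 + h2) \<in> adjoin m"
      by (intro mem graded_idealD(3)[OF gB] 1 2)
    then show ?thesis by (simp add: 1(1) 2(1) algebra_simps)
  qed
  show "k * f \<in> adjoin (e + m)" if k: "k \<in> forms X e" and f: "f \<in> adjoin m" for k f
  proof -
    obtain b h where f: "f = b + g * h" "b \<in> B m" "h \<in> ?A"
      using f unfolding adjoin_def by blast
    have "k * h \<in> (if a \<le> e + m then A (e + m - a) else {0})"
      using f(3) graded_idealD(4)[OF gA k, of h "m - a"] graded_idealD(2)[OF gA] by (auto split: if_splits)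
    then have "k * b + g * (k * h) \<in> adjoin (e + m)"
      by (intro mem graded_idealD(4)[OF gB k] f)
    then show ?thesis by (simp add: f(1) algebra_simps)
  qed
  show "\<tau> f \<in> adjoin m" if f: "f \<in> adjoin m" for f
  proof -
    obtain b h where f: "f = b + g * h" "b \<in> B m" "h \<in> ?A"
      using f unfolding adjoin_def by blast
    have "\<tau> h \<in> ?A" using f(3) stable_idealD(2)[OF A] by (auto split: if_splits)
    then have "\<tau> b + g * \<tau> h \<in> adjoin m" by (intro mem stable_idealD(2)[OF B] f)
    then show ?thesis by (simp add: f(1) hom_add hom_mult g(2))
  qed
qed

lemma stable_colon: "stable_ideal colon"
  unfolding stable_ideal_def graded_ideal_def
proof (intro conjI allI ballI)
  interpret comm_ring_hom \<tau> by (rule \<tau>_hom)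
  fix m e
  show "colon m \<subseteq> forms X m" using graded_idealD(1)[OF gA] by (auto simp: colon_def)
  show "0 \<in> colon m" using graded_idealD(2)[OF gA] graded_idealD(2)[OF gB] by (simp add: colon_def)
  show "f1 + f2 \<in> colon m" if "f1 \<in> colon m" "f2 \<in> colon m" for f1 f2
    using that graded_idealD(3)[OF gA] graded_idealD(3)[OF gB] by (auto simp: colon_def distrib_left)
  show "k * f \<in> colon (e + m)" if k: "k \<in> forms X e" and f: "f \<in> colon m" for k f
  proof -
    have "k * (g * f) \<in> B (e + (a + m))" using f by (intro graded_idealD(4)[OF gB k]) (simp add: colon_def)
    moreover have "k * f \<in> A (e + m)" using f by (intro graded_idealD(4)[OF gA k]) (simp add: colon_def)
    ultimately show ?thesis by (simp add: colon_def ac_simps)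
  qed
  show "\<tau> f \<in> colon m" if "f \<in> colon m" for f
    using that stable_idealD(2)[OF A, of f m] stable_idealD(2)[OF B, of "g * f" "a + m"]
    by (auto simp: colon_def hom_mult g(2))
qed

lemma colon_le: "colon m \<subseteq> A m"
  by (auto simp: colon_def)

lemma le_colon: "B m \<subseteq> colon m"
  using B_le graded_idealD(4)[OF gB g(1)] by (auto simp: colon_def)

text \<open>Multiplication by \<open>g\<close> maps \<open>A\<close>/\<open>colon\<close> in degree
  \<open>m\<close> isomorphically onto \<open>adjoin\<close>/\<open>B\<close> in degree
  \<open>a + m\<close>.\<close>

lemma hilb_adjoin_colon: "hilb A m - hilb colon m = hilb adjoin (a + m) - hilb B (a + m)"
proof (rule hilb_diff_eq_if_semilinear[where T = "(*) g" and \<sigma> = id and X = X])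
  show "\<exists>v\<in>A m. w - g * v \<in> B (a + m)" if w: "w \<in> adjoin (a + m)" for w
  proof -
    from w obtain b f where "w = b + g * f" "b \<in> B (a + m)" "f \<in> A m"
      unfolding adjoin_def by auto
    then show ?thesis by (intro bexI[of _ f]) auto
  qed
  show "g * v \<in> B (a + m) \<longleftrightarrow> v \<in> colon m" if "v \<in> A m" for v
    using that by (simp add: colon_def)
qed (use A B stable_colon stable_adjoin le_adjoin colon_le mult_mem_adjoin in
      \<open>auto simp: stable_ideal_def distrib_left mult.left_commute\<close>)

end

text \<open>The forms in \<open>done\<close> already kill \<open>A\<close>/\<open>B\<close>, those
  in \<open>rest\<close> are still to be treated. Cokernel and kernel of the next form are killed by
  it as well, so it moves to \<open>done\<close> for both. Once \<open>rest\<close> is empty,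
  \<open>kills\<close> makes the product of the variables kill \<open>A\<close>/\<open>B\<close>,
  and the divisibility theorem applies.\<close>

lemma eventually_dvd_fold_fdiff:
  fixes gs :: "((nat, 'a) mpoly \<times> nat) list"
  assumes gs: "\<And>g a. (g, a) \<in> set gs \<Longrightarrow> g \<in> forms X a \<and> \<tau> g = g"
    and kills: "\<And>A B m f. stable_ideal A \<Longrightarrow> stable_ideal B \<Longrightarrow>
      (\<And>g a m f. (g, a) \<in> set gs \<Longrightarrow> f \<in> A m \<Longrightarrow> g * f \<in> B (a + m)) \<Longrightarrow>
      f \<in> A m \<Longrightarrow> (\<Prod>j<p. var j) * f \<in> B (p + m)"
    and "set gs \<subseteq> set done \<union> set rest" "set rest \<subseteq> set gs"
    and "stable_ideal A" "stable_ideal B" "\<And>m. B m \<subseteq> A m"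
    and "\<And>g a m f. (g, a) \<in> set done \<Longrightarrow> f \<in> A m \<Longrightarrow> g * f \<in> B (a + m)"
  shows "\<exists>M. \<forall>m\<ge>M. int p dvd fold fdiff (map snd rest) (\<lambda>m. hilb A m - hilb B m) m"
  using assms(3-8)
proof (induction rest arbitrary: "done" A B)
  case Nil
  have "(\<Prod>j<p. var j) * f \<in> B (p + m)" if "f \<in> A m" for f m
    using Nil.prems that by (intro kills[of A B]) auto
  then show ?case using hilb_dvd_if_prod_var_kills[OF Nil.prems(3-5)] by simp
next
  case (Cons ga rest)
  obtain g a where ga: "ga = (g, a)" by (cases ga)
  have g: "g \<in> forms X a" "\<tau> g = g" using gs Cons.prems(2) ga by auto
  note ctx = Cons.prems(3-5) g
  let ?C = "adjoin A B g a" and ?K = "colon A B g a"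
  let ?D = "fold fdiff (map snd rest)"
  have "\<exists>M. \<forall>m\<ge>M. int p dvd ?D (\<lambda>m. hilb A m - hilb ?C m) m"
  proof (rule Cons.IH[of "ga # done"])
    show "g' * f \<in> ?C (a' + m)" if "(g', a') \<in> set (ga # done)" "f \<in> A m" for g' a' m f
      using that mult_mem_adjoin[OF ctx that(2)] subsetD[OF le_adjoin[OF ctx] Cons.prems(6)]
      by (auto simp: ga)
  qed (use Cons.prems stable_adjoin[OF ctx] adjoin_le[OF ctx] in auto)
  then obtain M where M: "\<And>m. M \<le> m \<Longrightarrow> int p dvd ?D (\<lambda>m. hilb A m - hilb ?C m) m" by blast
  have "\<exists>M. \<forall>m\<ge>M. int p dvd ?D (\<lambda>m. hilb ?K m - hilb B m) m"
  proof (rule Cons.IH[of "ga # done"])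
    show "g' * f \<in> B (a' + m)" if "(g', a') \<in> set (ga # done)" "f \<in> ?K m" for g' a' m f
      using that Cons.prems(6) colon_le[OF ctx] by (auto simp: ga colon_def[OF ctx])
  qed (use Cons.prems stable_colon[OF ctx] le_colon[OF ctx] in auto)
  then obtain M' where M': "\<And>m. M' \<le> m \<Longrightarrow> int p dvd ?D (\<lambda>m. hilb ?K m - hilb B m) m" by blast
  \<comment> \<open>The alternating sum of dimensions along kernel, module, shifted module and
    cokernel: the cokernel counts in degree \<open>m + a\<close>, the kernel in degree
    \<open>m\<close>.\<close>
  have "fdiff a (\<lambda>m. hilb A m - hilb B m)
      = (\<lambda>m. (hilb A (m + a) - hilb ?C (m + a)) - (hilb ?K m - hilb B m))"
    using hilb_adjoin_colon[OF ctx] by (auto simp: fdiff_def fun_eq_iff algebra_simps)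
  then have "?D (fdiff a (\<lambda>m. hilb A m - hilb B m))
      = (\<lambda>m. ?D (\<lambda>m. hilb A m - hilb ?C m) (m + a) - ?D (\<lambda>m. hilb ?K m - hilb B m) m)"
    using fold_fdiff_diff[of "map snd rest" "\<lambda>m. hilb A (m + a) - hilb ?C (m + a)" "\<lambda>m. hilb ?K m - hilb B m"]
      fold_fdiff_shift[of "map snd rest" "\<lambda>m. hilb A m - hilb ?C m" a] by simp
  then have "fold fdiff (map snd (ga # rest)) (\<lambda>m. hilb A m - hilb B m)
      = (\<lambda>m. ?D (\<lambda>m. hilb A m - hilb ?C m) (m + a) - ?D (\<lambda>m. hilb ?K m - hilb B m) m)"
    by (simp add: ga)
  moreover have "int p dvd ?D (\<lambda>m. hilb A m - hilb ?C m) (m + a) - ?D (\<lambda>m. hilb ?K m - hilb B m) m"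
    if "max M M' \<le> m" for m
    using that by (intro dvd_diff M M') auto
  ultimately show ?case by (intro exI[of _ "max M M'"]) simp
qed

text \<open>Taking the polynomial ring as module, the \<open>p - 1\<close> differences of its
  Hilbert function give the product of the \<open>a i\<close>. This would be divisible by the prime
  \<open>p\<close>, although each factor lies strictly between 0 and \<open>p\<close>.\<close>

theorem prod_var_not_combination:
  fixes G H :: "nat \<Rightarrow> (nat, 'a) mpoly" and a :: "nat \<Rightarrow> nat"
  assumes G: "\<And>i. i < p - 1 \<Longrightarrow> G i \<in> forms X (a i) \<and> \<tau> (G i) = G i"
    and a: "\<And>i. i < p - 1 \<Longrightarrow> 0 < a i \<and> a i < p"
    and H: "\<And>i. i < p - 1 \<Longrightarrow> H i \<in> forms X (p - a i)"
  shows "(\<Prod>j<p. var j) \<noteq> (\<Sum>i<p - 1. G i * H i)"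
proof
  assume eq: "(\<Prod>j<p. var j) = (\<Sum>i<p - 1. G i * H i)"
  define as where "as = map a [0..<p - 1]"
  define gs where "gs = map (\<lambda>i. (G i, a i)) [0..<p - 1]"
  let ?Z = "\<lambda>d. {0} :: (nat, 'a) mpoly set"
  have "\<exists>M. \<forall>m\<ge>M. int p dvd fold fdiff (map snd gs) (\<lambda>m. hilb (forms X :: _ \<Rightarrow> (nat, 'a) mpoly set) m - hilb ?Z m) m"
  proof (rule eventually_dvd_fold_fdiff[of gs "[]"])
    interpret comm_ring_hom \<tau> by (rule \<tau>_hom)
    show "stable_ideal (forms X)" "stable_ideal ?Z"
      by (auto simp: stable_ideal_def graded_ideal_forms graded_ideal_zero \<tau>_forms)
    show "(\<Prod>j<p. var j) * f \<in> B (p + m)"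
      if A: "stable_ideal A" and B: "stable_ideal B"
        and kill: "\<And>g a m f. (g, a) \<in> set gs \<Longrightarrow> f \<in> A m \<Longrightarrow> g * f \<in> B (a + m)" and f: "f \<in> A m"
      for A B m f
    proof -
      \<comment> \<open>A module killed by all \<open>G i\<close> is killed by the combination,
        which is the product of the variables.\<close>
      have "H i * (G i * f) \<in> B (p + m)" if i: "i < p - 1" for i
      proof -
        have "G i * f \<in> B (a i + m)" using i f by (intro kill) (auto simp: gs_def)
        then have "H i * (G i * f) \<in> B ((p - a i) + (a i + m))"
          by (rule graded_idealD(4)[OF stable_idealD(1)[OF B] H[OF i]])
        then show ?thesis using a[OF i] by simp
      qed
      then have "(\<Sum>i<p - 1. H i * (G i * f)) \<in> B (p + m)"
        by (intro graded_ideal_sum[OF stable_idealD(1)[OF B]]) auto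
      then show ?thesis by (simp add: eq sum_distrib_left ac_simps)
    qed
  qed (use G in \<open>auto simp: gs_def\<close>)
  moreover have "map snd gs = as" by (simp add: gs_def as_def)
  moreover have "hilb ?Z m = 0" for m
    unfolding hilb_def by (subst mpoly.dim_unique[of "{}"]) (simp_all add: mpoly.independent_empty)
  moreover have "hilb (forms X :: _ \<Rightarrow> (nat, 'a) mpoly set) = (\<lambda>m. int ((m + 0 + length as) choose length as))"
    using card_monoms[of "p - 1"] p_pos by (auto simp: hilb_forms as_def)
  ultimately have "int p dvd int (prod_list as)"
    using fold_fdiff_binomial[of as 0] by auto
  then have "p dvd prod_list as" by (simp only: int_dvd_int_iff)
  then have "p dvd (\<Prod>i<p - 1. a i)"
    unfolding as_def by (simp add: prod.list_conv_set_nth atLeast0LessThan)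
  then obtain i where "i < p - 1" "p dvd a i"
    using prime_p by (auto simp: prime_dvd_prod_iff)
  then show False using a[of i] by (auto dest: dvd_imp_le)
qed

end

section \<open>Specialising the generic determinant to a norm form\<close>

lemma homogeneous_in_forms:
  assumes "f \<in> polys_in X" "homogeneous f"
  shows "f \<in> forms X (total_degree f)"
proof (cases "f = 0")
  case False
  obtain d where d: "\<And>m. m \<in> Poly_Mapping.keys f \<Longrightarrow> monom_degree m = d"
    using assms(2) by (auto simp: homogeneous_def)
  obtain m where "m \<in> Poly_Mapping.keys f" using False by (metis keys_eq_empty ex_in_conv)
  then have "monom_degree ` Poly_Mapping.keys f = {d}" using d by force
  then have "total_degree f = d" by (simp add: total_degree_def)
  then show ?thesis using assms(1) d by (auto simp: forms_def monoms_def polys_in_def)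
qed simp

lemma total_degree_forms:
  assumes "f \<in> forms X d" "f \<noteq> 0"
  shows "total_degree f = d"
proof -
  obtain m where "m \<in> Poly_Mapping.keys f" using assms(2) by (metis keys_eq_empty ex_in_conv)
  then have "monom_degree ` Poly_Mapping.keys f = {d}"
    using assms(1) unfolding forms_def monoms_def by force
  then show ?thesis by (simp add: total_degree_def)
qed

lemma total_degree_le: "f \<in> forms X d \<Longrightarrow> total_degree f \<le> d"
  using total_degree_forms[of f X d] by (cases "f = 0") (simp_all add: total_degree_def)

lemma homogeneous_forms: "f \<in> forms X d \<Longrightarrow> homogeneous f"
  unfolding forms_def monoms_def homogeneous_def by blast

text \<open>Only the component of degree \<open>d\<close> is compared. A strength decomposition does
  not prescribe the degree of \<open>g i * h i\<close>, so summands of a wrong total degree have to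
  be discarded.\<close>

lemma form_eq_sum_same_degree:
  assumes "f \<in> forms X d" "finite I" "\<And>i. i \<in> I \<Longrightarrow> F i \<in> forms X (e i)" "f = (\<Sum>i\<in>I. F i)"
  shows "f = (\<Sum>i\<in>I. if e i = d then F i else 0)"
proof (rule poly_mapping_eqI)
  fix m
  have lookup_F: "Poly_Mapping.lookup (F i) m = 0" if "i \<in> I" "monom_degree m \<noteq> e i" for i
    using assms(3)[OF that(1)] that(2) by (auto simp: forms_def monoms_def in_keys_iff)
  show "Poly_Mapping.lookup f m = Poly_Mapping.lookup (\<Sum>i\<in>I. if e i = d then F i else 0) m"
  proof (cases "monom_degree m = d")
    case True
    have "Poly_Mapping.lookup f m = (\<Sum>i\<in>I. Poly_Mapping.lookup (F i) m)"
      by (simp add: assms(4) lookup_sum)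
    also have "\<dots> = (\<Sum>i\<in>I. Poly_Mapping.lookup (if e i = d then F i else 0) m)"
      using lookup_F True by (intro sum.cong) auto
    finally show ?thesis by (simp add: lookup_sum)
  next
    case False
    then have "Poly_Mapping.lookup f m = 0"
      using assms(1) by (auto simp: forms_def monoms_def in_keys_iff)
    moreover have "Poly_Mapping.lookup (if e i = d then F i else 0) m = 0" if "i \<in> I" for i
      using lookup_F[OF that] False by auto
    ultimately show ?thesis by (simp add: lookup_sum)
  qed
qed

lemma forms_sign_mult: "f \<in> forms X d \<Longrightarrow> of_int (sign \<pi>) * f \<in> forms X d"
  using forms_scale[of f X d "-1"] by (auto simp: sign_def single_uminus)

lemma generic_det_expand:
  "generic_det n = (\<Sum>\<pi> | \<pi> permutes {0..<n}. signof \<pi> * (\<Prod>i = 0..<n. var (i, \<pi> i)))"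
  unfolding generic_det_def generic_matrix_def det_def
  by (auto intro!: sum.cong prod.cong simp: permutes_nat_less)

lemma generic_det_forms: "generic_det n \<in> forms ({0..<n} \<times> {0..<n}) n"
proof -
  have "(\<Prod>i = 0..<n. var (i, \<pi> i) :: (nat \<times> nat, 'a::comm_ring_1) mpoly) \<in> forms ({0..<n} \<times> {0..<n}) (\<Sum>i = 0..<n. 1)"
    if "\<pi> permutes {0..<n}" for \<pi>
    using that by (intro forms_prod forms_var) (auto simp: permutes_in_image)
  then have "(\<Sum>\<pi> | \<pi> permutes {0..<n}. signof \<pi> * (\<Prod>i = 0..<n. var (i, \<pi> i) :: (nat \<times> nat, 'a) mpoly))
      \<in> forms ({0..<n} \<times> {0..<n}) n"
    by (intro forms_sum forms_sign_mult) auto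
  then show ?thesis by (simp add: generic_det_expand)
qed

text \<open>A kernel vector would be the coefficients of a nonzero polynomial of degree below
  \<open>n\<close> with \<open>n\<close> distinct roots.\<close>

lemma det_vandermonde_nonzero:
  fixes x :: "nat \<Rightarrow> 'a::field"
  assumes "inj_on x {..<n}"
  shows "det (mat n n (\<lambda>(i, j). x i ^ j)) \<noteq> 0"
proof
  let ?V = "mat n n (\<lambda>(i, j). x i ^ j)"
  assume "det ?V = 0"
  then obtain v where v: "v \<in> carrier_vec n" "v \<noteq> 0\<^sub>v n" "?V *\<^sub>v v = 0\<^sub>v n"
    using det_0_iff_vec_prod_zero_field[of ?V n] by auto
  define q where "q = (\<Sum>j<n. monom (v $ j) j)"
  have coeff_q: "coeff q j = (if j < n then v $ j else 0)" for j
    by (auto simp: q_def coeff_sum)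
  have "poly q (x i) = 0" if "i < n" for i
  proof -
    have "poly q (x i) = (\<Sum>j = 0..<n. x i ^ j * v $ j)"
      by (simp add: q_def poly_sum poly_monom atLeast0LessThan mult.commute)
    also have "\<dots> = (?V *\<^sub>v v) $ i" using that v(1) by (auto simp: scalar_prod_def intro!: sum.cong)
    also have "\<dots> = 0" using that v(3) by simp
    finally show ?thesis .
  qed
  then have roots: "x ` {..<n} \<subseteq> {y. poly q y = 0}" by auto
  have "\<exists>j<n. v $ j \<noteq> 0"
  proof (rule ccontr)
    assume "\<not> ?thesis"
    then have "v = 0\<^sub>v n" using v(1) by (intro eq_vecI) auto
    then show False using v(2) by simp
  qed
  then obtain j where j: "j < n" "v $ j \<noteq> 0" by blast
  then have "q \<noteq> 0" using coeff_q[of j] by auto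
  moreover have "degree q < n"
    using j(1) coeff_q by (intro degree_lessI) auto
  moreover have "n \<le> card {y. poly q y = 0}"
    using card_mono[OF poly_roots_finite[OF \<open>q \<noteq> 0\<close>] roots] card_image[OF assms] by simp
  ultimately show False using card_poly_roots_bound[of q] by simp
qed

section \<open>Substituting an invariant conjugate of the diagonal matrix\<close>

context cyclic_action
begin

lemma pred_succ_mod: "j < p \<Longrightarrow> ((j + 1) mod p + (p - 1)) mod p = j"
  by (cases "j + 1 = p") auto

lemma bij_betw_succ: "bij_betw (\<lambda>j. (j + 1) mod p) {..<p} {..<p}"
proof (rule bij_betwI[where g = "\<lambda>j. (j + (p - 1)) mod p"])
  show "((j + (p - 1)) mod p + 1) mod p = j" if "j \<in> {..<p}" for j
    using that p_pos by (simp add: mod_Suc_eq)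
qed (use pred_succ_mod p_pos in auto)

lemma sum_succ_reindex: "(\<Sum>j<p. f ((j + 1) mod p)) = (\<Sum>j<p. f j)"
  using sum.reindex_bij_betw[OF bij_betw_succ] .

text \<open>\<open>\<iota>\<close> puts the coefficients into the fixed field of \<sigma>, and the
  distinct conjugates of \<open>z\<close> make a Vandermonde matrix invertible. Substituting the
  conjugated diagonal matrix preserves degrees, makes every \<open>g i\<close> invariant under
  \<tau>, and sends the determinant to the product of the variables.\<close>

theorem strength_decomposition_lower_bound:
  fixes \<iota> :: "'k::comm_ring_1 \<Rightarrow> 'a"
  assumes \<iota>: "comm_ring_hom \<iota>" "\<And>c. \<sigma> (\<iota> c) = \<iota> c"
    and z: "inj_on (\<lambda>i. (\<sigma> ^^ i) z) {..<p}"
    and dec: "strength_decomposition ({0..<p} \<times> {0..<p}) (generic_det p :: (nat \<times> nat, 'k) mpoly) r g h"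
  shows "p \<le> r"
proof (rule ccontr)
  assume "\<not> p \<le> r"
  then have r: "r \<le> p - 1" by simp
  interpret s: comm_ring_hom \<sigma> by (rule \<sigma>_hom)
  interpret t: comm_ring_hom \<tau> by (rule \<tau>_hom)
  \<comment> \<open>The rows belong to the conjugates of \<open>z\<close>, so \<sigma> permutes the
    rows cyclically.\<close>
  define V where "V = mat p p (\<lambda>(i, j). ((\<sigma> ^^ i) z) ^ j)"
  have V: "V \<in> carrier_mat p p" by (simp add: V_def)
  have "det V \<noteq> 0" unfolding V_def by (rule det_vandermonde_nonzero[OF z])
  then obtain W where W: "W \<in> carrier_mat p p" "W * V = 1\<^sub>m p"
    using det_non_zero_imp_unit[OF V, of "()"] unfolding Units_def ring_mat_def by auto
  have VW: "V * W = 1\<^sub>m p" by (rule mat_mult_left_right_inverse[OF W(1) V W(2)])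
  have mult_entry: "(\<Sum>j<p. M $$ (l, j) * N $$ (j, k)) = (M * N) $$ (l, k)"
    if "M \<in> carrier_mat p p" "N \<in> carrier_mat p p" "l < p" "k < p" for M N :: "'b::comm_ring_1 mat" and l k
    using that by (auto simp: scalar_prod_def atLeast0LessThan intro!: sum.cong)
  have \<sigma>V: "\<sigma> (V $$ (j, k)) = V $$ ((j + 1) mod p, k)" if "j < p" "k < p" for j k
  proof -
    have "\<sigma> (V $$ (j, k)) = ((\<sigma> ^^ Suc j) z) ^ k" using that by (simp add: V_def s.hom_power)
    also have "(\<sigma> ^^ Suc j) z = (\<sigma> ^^ ((j + 1) mod p)) z"
      using that \<sigma>_order[of z] by (cases "Suc j = p") auto
    finally show ?thesis using that p_pos by (simp add: V_def)
  qed
  \<comment> \<open>\<open>W'\<close> is \<sigma> applied to the inverse \<open>W\<close>, with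
    columns rotated to match the rows of \<open>V\<close>. It is again a left inverse of
    \<open>V\<close>, hence equal to \<open>W\<close>: so \<sigma> permutes the columns of
    \<open>W\<close> cyclically.\<close>
  define W' where "W' = mat p p (\<lambda>(l, j). \<sigma> (W $$ (l, (j + (p - 1)) mod p)))"
  have W': "W' \<in> carrier_mat p p" by (simp add: W'_def)
  have W'_succ: "W' $$ (l, (j + 1) mod p) = \<sigma> (W $$ (l, j))" if "l < p" "j < p" for l j
    using that p_pos pred_succ_mod[OF that(2)] by (simp add: W'_def)
  have "W' * V = 1\<^sub>m p"
  proof (rule eq_matI)
    fix l k assume "l < dim_row (1\<^sub>m p)" "k < dim_col (1\<^sub>m p)"
    then have lk: "l < p" "k < p" by simp_all
    have "(W' * V) $$ (l, k) = (\<Sum>j<p. W' $$ (l, (j + 1) mod p) * V $$ ((j + 1) mod p, k))"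
      using mult_entry[OF W' V lk] sum_succ_reindex[of "\<lambda>j. W' $$ (l, j) * V $$ (j, k)"] by simp
    also have "\<dots> = (\<Sum>j<p. \<sigma> (W $$ (l, j) * V $$ (j, k)))"
      using lk by (intro sum.cong) (auto simp: W'_succ[unfolded Suc_eq_plus1[symmetric]] \<sigma>V s.hom_mult)
    also have "\<dots> = \<sigma> ((W * V) $$ (l, k))"
      by (simp only: mult_entry[OF W(1) V lk, symmetric] s.hom_sum)
    also have "\<dots> = 1\<^sub>m p $$ (l, k)" unfolding W(2) using lk by (cases "l = k") simp_all
    finally show "(W' * V) $$ (l, k) = 1\<^sub>m p $$ (l, k)" .
  qed (use W' V in auto)
  then have "(W' * V) * W = W" using W(1) by simp
  then have "W' * (V * W) = W" using assoc_mult_mat[OF W' V W(1)] by simp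
  then have "W' = W" using W' by (simp add: VW)
  then have \<sigma>W: "\<sigma> (W $$ (l, j)) = W $$ (l, (j + 1) mod p)" if "l < p" "j < p" for l j
    using W'_succ[OF that] by simp
  \<comment> \<open>The entries of \<open>W\<close>, diagonal matrix of the variables,
    \<open>V\<close> multiplied out. Applying \<tau> merely rotates the summation index
    \<open>j\<close>.\<close>
  define A where "A = (\<lambda>(l, k). \<Sum>j<p. Poly_Mapping.single 0 (W $$ (l, j) * V $$ (j, k)) * var j)"
  have A_forms: "A lk \<in> forms X 1" for lk
    unfolding A_def by (cases lk) (auto intro!: forms_sum forms_scale forms_var[unfolded One_nat_def])
  have A_\<tau>: "\<tau> (A (l, k)) = A (l, k)" if "l < p" "k < p" for l k
  proof -
    have "\<tau> (A (l, k)) = (\<Sum>j<p. Poly_Mapping.single 0 (W $$ (l, (j + 1) mod p) * V $$ ((j + 1) mod p, k)) * var ((j + 1) mod p))"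
      using that by (simp add: A_def t.hom_sum t.hom_mult \<tau>_const \<tau>_var s.hom_mult \<sigma>V \<sigma>W)
    also have "\<dots> = A (l, k)"
      using sum_succ_reindex[of "\<lambda>j. Poly_Mapping.single 0 (W $$ (l, j) * V $$ (j, k)) * var j"] by (simp add: A_def)
    finally show ?thesis .
  qed
  let ?c = "Poly_Mapping.single 0 :: 'a \<Rightarrow> (nat, 'a) mpoly"
  interpret c: comm_ring_hom ?c by (rule comm_ring_hom_const)
  define D where "D = mat p p (\<lambda>(i, j). if i = j then var i else 0 :: (nat, 'a) mpoly)"
  have D: "D \<in> carrier_mat p p" by (simp add: D_def)
  let ?W = "map_mat ?c W" and ?V = "map_mat ?c V"
  have cW: "?W \<in> carrier_mat p p" and cV: "?V \<in> carrier_mat p p" using W(1) V by auto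
  have A_mat: "mat p p A = ?W * D * ?V"
  proof (rule eq_matI)
    fix l k assume "l < dim_row (?W * D * ?V)" "k < dim_col (?W * D * ?V)"
    then have lk: "l < p" "k < p" using W(1) V by simp_all
    have WD: "(?W * D) $$ (l, j) = ?c (W $$ (l, j)) * var j" if "j < p" for j
    proof -
      have "(?W * D) $$ (l, j) = (\<Sum>i<p. ?W $$ (l, i) * D $$ (i, j))" using mult_entry[OF cW D lk(1) that] by simp
      also have "\<dots> = (\<Sum>i<p. if i = j then ?c (W $$ (l, i)) * var i else 0)"
        using that lk W(1) by (intro sum.cong) (auto simp: D_def)
      finally show ?thesis using that by simp
    qed
    have "(?W * D * ?V) $$ (l, k) = (\<Sum>j<p. (?W * D) $$ (l, j) * ?V $$ (j, k))"
      using mult_entry[OF mult_carrier_mat[OF cW D] cV lk] by simp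
    also have "\<dots> = (\<Sum>j<p. ?c (W $$ (l, j) * V $$ (j, k)) * var j)"
      using lk V by (intro sum.cong refl) (simp add: WD c.hom_mult ac_simps)
    finally show "mat p p A $$ (l, k) = (?W * D * ?V) $$ (l, k)" using lk by (simp add: A_def)
  qed (use W(1) V in auto)
  have "det (mat p p A) = det ?W * det D * det ?V"
    unfolding A_mat using det_mult[OF mult_carrier_mat[OF cW D] cV] det_mult[OF cW D] by simp
  also have "det ?W * det D * det ?V = det D * ?c (det W * det V)"
    by (simp add: c.hom_det c.hom_mult ac_simps)
  also have "det W * det V = 1" using det_mult[OF W(1) V] W(2) by simp
  also have "det D = (\<Prod>j<p. var j)"
  proof -
    have "upper_triangular D" by (auto simp: D_def upper_triangular_def)
    then have "det D = prod_list (diag_mat D)" by (rule det_upper_triangular[OF _ D])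
    also have "\<dots> = (\<Prod>j<p. var j)"
      by (simp add: prod.list_conv_set_nth diag_mat_def D_def atLeast0LessThan)
    finally show ?thesis .
  qed
  finally have det_A: "det (mat p p A) = (\<Prod>j<p. var j)" by simp
  have \<iota>c: "comm_ring_hom (\<lambda>c. ?c (\<iota> c))"
  proof -
    interpret i: comm_ring_hom \<iota> by (rule \<iota>(1))
    show ?thesis by standard (auto simp: i.hom_add i.hom_mult c.hom_add c.hom_mult)
  qed
  let ?ev = "peval (\<lambda>c. ?c (\<iota> c)) A"
  interpret ev: comm_ring_hom ?ev by (rule peval_comm_ring_hom[OF \<iota>c])
  let ?X = "{0..<p} \<times> {0..<p}"
  have ev_forms: "?ev f \<in> forms X d" if "f \<in> forms ?X d" for f d
    using that by (rule peval_forms) (rule forms_const A_forms)+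
  have ev_\<tau>: "\<tau> (?ev f) = ?ev f" if "f \<in> polys_in ?X" for f
  proof -
    have "\<tau> (?ev f) = peval (\<tau> \<circ> (\<lambda>c. ?c (\<iota> c))) (\<tau> \<circ> A) f" by (rule comm_ring_hom_peval[OF \<tau>_hom])
    also have "\<dots> = ?ev f"
      using that by (rule peval_cong) (auto simp: \<tau>_const \<iota>(2) A_\<tau>)
    finally show ?thesis .
  qed
  have "map_mat ?ev (generic_matrix p) = mat p p A"
    by (rule eq_matI) (auto simp: generic_matrix_def peval_var[OF \<iota>c])
  then have ev_det: "?ev (generic_det p) = (\<Prod>j<p. var j)"
    using ev.hom_det[of "generic_matrix p"] by (simp add: generic_det_def det_A)
  have dec': "g i \<in> polys_in ?X" "homogeneous (g i)" "0 < total_degree (g i)" "total_degree (g i) < p"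
    "h i \<in> polys_in ?X" "homogeneous (h i)" if "i < r" for i
    using dec that total_degree_le[OF generic_det_forms[of p, where 'a = 'k]]
    unfolding strength_decomposition_def by (blast intro: less_le_trans)+
  let ?a = "\<lambda>i. total_degree (g i)" and ?b = "\<lambda>i. total_degree (h i)"
  have "(\<Prod>j<p. var j) = ?ev (\<Sum>i<r. g i * h i)"
    using ev_det dec unfolding strength_decomposition_def by metis
  then have "(\<Prod>j<p. var j) = (\<Sum>i<r. ?ev (g i) * ?ev (h i))"
    by (simp add: ev.hom_sum ev.hom_mult)
  moreover have "(\<Prod>j<p. var j :: (nat, 'a) mpoly) \<in> forms X p"
  proof -
    have "(\<Prod>j<p. var j :: (nat, 'a) mpoly) \<in> forms X (\<Sum>j<p. 1)"
      by (intro forms_prod forms_var)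
    then show ?thesis by simp
  qed
  moreover have "?ev (g i) * ?ev (h i) \<in> forms X (?a i + ?b i)" if "i < r" for i
    using dec'[OF that] by (intro forms_mult ev_forms homogeneous_in_forms)
  ultimately have eq: "(\<Prod>j<p. var j) = (\<Sum>i<r. if ?a i + ?b i = p then ?ev (g i) * ?ev (h i) else 0)"
    using form_eq_sum_same_degree[of "\<Prod>j<p. var j" X p "{..<r}" "\<lambda>i. ?ev (g i) * ?ev (h i)" "\<lambda>i. ?a i + ?b i"]
    by simp
  \<comment> \<open>Discarded summands lose only their \<open>H\<close> factor. Indices from
    \<open>r\<close> to \<open>p - 2\<close> are padded by 0 with nominal degree 1, which lies
    strictly between 0 and \<open>p\<close>.\<close>
  define G where "G i = (if i < r then ?ev (g i) else 0)" for i
  define H where "H i = (if i < r \<and> ?a i + ?b i = p then ?ev (h i) else 0)" for i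
  have "(\<Prod>j<p. var j) = (\<Sum>i<r. G i * H i)"
    unfolding eq by (intro sum.cong) (auto simp: G_def H_def)
  also have "\<dots> = (\<Sum>i<p - 1. G i * H i)"
    using r by (intro sum.mono_neutral_left) (auto simp: G_def)
  finally have "(\<Prod>j<p. var j) = (\<Sum>i<p - 1. G i * H i)" .
  moreover have "(\<Prod>j<p. var j) \<noteq> (\<Sum>i<p - 1. G i * H i)"
  proof (rule prod_var_not_combination[where a = "\<lambda>i. if i < r then ?a i else 1"])
    fix i
    show "G i \<in> forms X (if i < r then ?a i else 1) \<and> \<tau> (G i) = G i"
      using dec'[of i] by (auto simp: G_def ev_\<tau> intro!: ev_forms homogeneous_in_forms)
    show "0 < (if i < r then ?a i else 1) \<and> (if i < r then ?a i else 1) < p"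
      using dec'[of i] prime_gt_1_nat[OF prime_p] by auto
    show "H i \<in> forms X (p - (if i < r then ?a i else 1))"
    proof (cases "i < r \<and> ?a i + ?b i = p")
      case True
      then have "p - ?a i = ?b i" by linarith
      then show ?thesis
        using True dec'[of i] by (auto simp: H_def intro!: ev_forms homogeneous_in_forms)
    qed (simp only: H_def if_False forms_zero)
  qed
  ultimately show False by blast
qed

end

section \<open>The strength of the generic determinant\<close>

text \<open>Only meaningful for injective \<open>\<phi>\<close>: otherwise denominators may become \<open>0\<close>.\<close>

definition fract_map :: "('r::idom \<Rightarrow> 's::idom) \<Rightarrow> 'r fract \<Rightarrow> 's fract" where
  "fract_map \<phi> x = (THE y. \<exists>a b. b \<noteq> 0 \<and> x = Fract a b \<and> y = Fract (\<phi> a) (\<phi> b))"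

lemma fract_map_Fract:
  assumes "comm_ring_hom \<phi>" "inj \<phi>" "b \<noteq> 0"
  shows "fract_map \<phi> (Fract a b) = Fract (\<phi> a) (\<phi> b)"
proof -
  interpret comm_ring_hom \<phi> by fact
  have nz: "\<phi> c \<noteq> 0" if "c \<noteq> 0" for c using assms(2) that by (metis hom_zero injD)
  show ?thesis
    unfolding fract_map_def
  proof (rule the_equality)
    show "\<exists>a' b'. b' \<noteq> 0 \<and> Fract a b = Fract a' b' \<and> Fract (\<phi> a) (\<phi> b) = Fract (\<phi> a') (\<phi> b')"
      using assms(3) by blast
    show "y = Fract (\<phi> a) (\<phi> b)"
      if y: "\<exists>a' b'. b' \<noteq> 0 \<and> Fract a b = Fract a' b' \<and> y = Fract (\<phi> a') (\<phi> b')" for y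
    proof -
      obtain a' b' where *: "b' \<noteq> 0" "Fract a b = Fract a' b'" "y = Fract (\<phi> a') (\<phi> b')"
        using y by blast
      then have "a * b' = a' * b" using assms(3) by (simp add: eq_fract)
      then have "\<phi> a * \<phi> b' = \<phi> a' * \<phi> b" by (metis hom_mult)
      then show ?thesis using * assms(3) nz by (simp add: eq_fract)
    qed
  qed
qed

lemma fract_map_hom:
  assumes "comm_ring_hom \<phi>" "inj \<phi>"
  shows "comm_ring_hom (fract_map \<phi>)"
proof -
  interpret comm_ring_hom \<phi> by fact
  have nz: "\<phi> c \<noteq> 0" if "c \<noteq> 0" for c using assms(2) that by (metis hom_zero injD)
  note F = fract_map_Fract[OF assms]
  show ?thesis
  proof
    show "fract_map \<phi> (x + y) = fract_map \<phi> x + fract_map \<phi> y" for x y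
      by (cases x; cases y) (simp add: F nz hom_add hom_mult)
    show "fract_map \<phi> (x * y) = fract_map \<phi> x * fract_map \<phi> y" for x y
      by (cases x; cases y) (simp add: F nz hom_mult)
    show "fract_map \<phi> 0 = 0" "fract_map \<phi> 1 = 1"
      using F[of 1 0] F[of 1 1] by (simp_all add: Zero_fract_def One_fract_def)
  qed
qed

lemma funpow_fract_map:
  fixes \<phi> :: "'r::idom \<Rightarrow> 'r"
  assumes "comm_ring_hom \<phi>" "inj \<phi>" "b \<noteq> 0"
  shows "(fract_map \<phi> ^^ n) (Fract a b) = Fract ((\<phi> ^^ n) a) ((\<phi> ^^ n) b)"
proof (induction n)
  case (Suc n)
  interpret comm_ring_hom \<phi> by fact
  have "\<phi> c \<noteq> 0" if "c \<noteq> 0" for c using assms(2) that by (metis hom_zero injD)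
  then have "(\<phi> ^^ n) b \<noteq> 0" using assms(3) by (induction n) simp_all
  then show ?case using Suc fract_map_Fract[OF assms(1,2)] by simp
qed simp

text \<open>The type has infinitely many variables. Those from \<open>n\<close> on stay fixed, so
  that the \<open>n\<close>-th power is the identity on the whole ring and therefore on its field of
  fractions.\<close>

definition cycle_vars :: "nat \<Rightarrow> (nat, 'k::comm_ring_1) mpoly \<Rightarrow> (nat, 'k) mpoly" where
  "cycle_vars n = peval (Poly_Mapping.single 0) (\<lambda>j. var (if j < n then (j + 1) mod n else j))"

lemma cycle_vars_hom: "comm_ring_hom (cycle_vars n)"
  unfolding cycle_vars_def by (rule peval_comm_ring_hom[OF comm_ring_hom_const])

lemma cycle_vars_const: "cycle_vars n (Poly_Mapping.single 0 c) = Poly_Mapping.single 0 c"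
  unfolding cycle_vars_def by (rule peval_const[OF comm_ring_hom_const])

lemma cycle_vars_var: "cycle_vars n (var j) = var (if j < n then (j + 1) mod n else j)"
  unfolding cycle_vars_def by (rule peval_var[OF comm_ring_hom_const])

lemma funpow_cycle_vars_var:
  "(cycle_vars n ^^ i) (var j) = var (if j < n then (j + i) mod n else j)"
  by (induction i) (auto simp: cycle_vars_var mod_Suc_eq)

lemma cycle_vars_order: "(cycle_vars n ^^ n) f = f"
proof -
  have const: "(cycle_vars n ^^ i) (Poly_Mapping.single 0 c) = Poly_Mapping.single 0 c" for i c
    by (induction i) (auto simp: cycle_vars_const)
  have "(cycle_vars n ^^ n) f = (cycle_vars n ^^ n) (peval (Poly_Mapping.single 0) var f)"
    by (simp add: peval_id)
  also have "\<dots> = peval ((cycle_vars n ^^ n) \<circ> Poly_Mapping.single 0) ((cycle_vars n ^^ n) \<circ> var) f"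
    by (rule comm_ring_hom_peval[OF comm_ring_hom_funpow[OF cycle_vars_hom]])
  also have "\<dots> = peval (Poly_Mapping.single 0) var f"
    by (rule peval_cong[of _ UNIV]) (auto simp: polys_in_def const funpow_cycle_vars_var)
  finally show ?thesis by (simp add: peval_id)
qed

lemma inj_cycle_vars: "n > 0 \<Longrightarrow> inj (cycle_vars n)"
proof (rule injI)
  fix f g :: "(nat, 'k::comm_ring_1) mpoly"
  assume n: "n > 0" and "cycle_vars n f = cycle_vars n g"
  then have "(cycle_vars n ^^ Suc (n - 1)) f = (cycle_vars n ^^ Suc (n - 1)) g"
    by (simp only: funpow_Suc_right comp_apply)
  then show "f = g" using n by (simp add: cycle_vars_order del: funpow.simps)
qed

lemma var_eq_iff: "(var i :: ('x, 'k::comm_ring_1) mpoly) = var j \<longleftrightarrow> i = j"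
proof
  assume "(var i :: ('x, 'k) mpoly) = var j"
  then have "Poly_Mapping.keys (var i :: ('x, 'k) mpoly) = Poly_Mapping.keys (var j :: ('x, 'k) mpoly)" by simp
  then have "Poly_Mapping.single i (1::nat) = Poly_Mapping.single j 1" by (simp add: var_def)
  then have "Poly_Mapping.keys (Poly_Mapping.single i (1::nat)) = Poly_Mapping.keys (Poly_Mapping.single j (1::nat))" by simp
  then show "i = j" by simp
qed simp

text \<open>The field is the fraction field of the polynomial ring with \<sigma> induced by cycling
  the first \<open>p\<close> variables; constants are fixed, and \<open>var 0\<close> has the
  \<open>p\<close> distinct conjugates \<open>var i\<close>.\<close>

theorem generic_det_strength_lower_bound:
  assumes p: "prime p"
    and dec: "strength_decomposition ({0..<p} \<times> {0..<p}) (generic_det p :: (nat \<times> nat, 'k::field) mpoly) r g h"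
  shows "p \<le> r"
proof -
  have p0: "p > 0" using p by (rule prime_gt_0_nat)
  let ?\<phi> = "cycle_vars p :: (nat, 'k) mpoly \<Rightarrow> _"
  have hom: "comm_ring_hom ?\<phi>" and inj: "inj ?\<phi>"
    by (rule cycle_vars_hom inj_cycle_vars[OF p0])+
  interpret cyclic_action p "fract_map ?\<phi>"
  proof (rule cyclic_action.intro)
    show "(fract_map ?\<phi> ^^ p) c = c" for c
      by (cases c) (simp add: funpow_fract_map[OF hom inj] cycle_vars_order)
  qed (rule p fract_map_hom[OF hom inj])+
  have pow: "(fract_map ?\<phi> ^^ i) (Fract (var 0) 1) = Fract (var i) 1" if "i < p" for i
  proof -
    interpret comm_ring_hom "?\<phi> ^^ i" by (rule comm_ring_hom_funpow[OF cycle_vars_hom])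
    show ?thesis using that by (simp add: funpow_fract_map[OF hom inj] funpow_cycle_vars_var)
  qed
  show ?thesis
  proof (rule strength_decomposition_lower_bound[OF _ _ _ dec])
    interpret comm_ring_hom "Poly_Mapping.single 0 :: 'k \<Rightarrow> (nat, 'k) mpoly" by (rule comm_ring_hom_const)
    show "comm_ring_hom (\<lambda>c::'k. Fract (Poly_Mapping.single 0 c :: (nat, 'k) mpoly) 1)"
      by standard (auto simp: hom_add hom_mult Zero_fract_def One_fract_def)
    interpret \<phi>: comm_ring_hom ?\<phi> by (rule hom)
    show "fract_map ?\<phi> (Fract (Poly_Mapping.single 0 c) 1) = Fract (Poly_Mapping.single 0 c) 1" for c
      by (simp add: fract_map_Fract[OF hom inj] cycle_vars_const)
    show "inj_on (\<lambda>i. (fract_map ?\<phi> ^^ i) (Fract (var 0) 1)) {..<p}"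
      by (rule inj_onI) (simp add: pow eq_fract var_eq_iff)
  qed
qed

text \<open>The monomial of \<open>\<rho>\<close> arises from no other permutation in
  \<open>S\<close>, so its coefficient is the sign of \<open>\<rho>\<close>. With \<open>I\<close>
  the full row set this treats the determinant, with row 0 omitted its cofactors.\<close>

lemma perm_sum_nonzero:
  assumes "finite S" "finite I" "\<rho> \<in> S"
    and inj: "\<And>\<pi>. \<pi> \<in> S \<Longrightarrow> (\<And>i. i \<in> I \<Longrightarrow> \<pi> i = \<rho> i) \<Longrightarrow> \<pi> = \<rho>"
  shows "(\<Sum>\<pi>\<in>S. signof \<pi> * (\<Prod>i\<in>I. var (i, \<pi> i))) \<noteq> (0 :: (nat \<times> nat, 'k::comm_ring_1) mpoly)"
proof
  let ?m = "\<lambda>\<pi>. \<Sum>i\<in>I. Poly_Mapping.single (i, \<pi> i) (1::nat)"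
  have prod: "finite J \<Longrightarrow> (\<Prod>i\<in>J. var (i, \<pi> i)) = (Poly_Mapping.single (\<Sum>i\<in>J. Poly_Mapping.single (i, \<pi> i) 1) 1 :: (nat \<times> nat, 'k) mpoly)"
    for J and \<pi> :: "nat \<Rightarrow> nat"
    by (induction J rule: finite_induct) (auto simp: var_def mult_single)
  have summand: "signof \<pi> * (\<Prod>i\<in>I. var (i, \<pi> i)) = (Poly_Mapping.single (?m \<pi>) (signof \<pi>) :: (nat \<times> nat, 'k) mpoly)" for \<pi>
    unfolding prod[OF assms(2)] by (simp add: mult_single flip: single_of_int)
  have m_eq: "?m \<pi> = ?m \<rho> \<longleftrightarrow> \<pi> = \<rho>" if "\<pi> \<in> S" for \<pi>
  proof
    assume eq: "?m \<pi> = ?m \<rho>"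
    have lookup_m: "Poly_Mapping.lookup (?m \<pi>') (i, j) = (if \<pi>' i = j then 1 else 0)" if "i \<in> I" for \<pi>' i j
    proof -
      have "Poly_Mapping.lookup (?m \<pi>') (i, j) = (\<Sum>k\<in>I. if k = i then (if \<pi>' i = j then 1 else 0) else 0)"
        unfolding lookup_sum by (intro sum.cong refl) (auto simp: lookup_single when_def)
      then show ?thesis using that assms(2) by simp
    qed
    have "\<pi> i = \<rho> i" if "i \<in> I" for i
    proof -
      have "Poly_Mapping.lookup (?m \<pi>) (i, \<rho> i) = 1"
        unfolding eq lookup_m[OF that] by simp
      then show ?thesis unfolding lookup_m[OF that] by (simp split: if_splits)
    qed
    then show "\<pi> = \<rho>" by (rule inj[OF \<open>\<pi> \<in> S\<close>])
  qed simp
  assume "(\<Sum>\<pi>\<in>S. signof \<pi> * (\<Prod>i\<in>I. var (i, \<pi> i))) = (0 :: (nat \<times> nat, 'k) mpoly)"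
  then have "Poly_Mapping.lookup (\<Sum>\<pi>\<in>S. Poly_Mapping.single (?m \<pi>) (signof \<pi>) :: (nat \<times> nat, 'k) mpoly) (?m \<rho>) = 0"
    by (simp add: summand)
  moreover have "Poly_Mapping.lookup (\<Sum>\<pi>\<in>S. Poly_Mapping.single (?m \<pi>) (signof \<pi>) :: (nat \<times> nat, 'k) mpoly) (?m \<rho>)
      = (\<Sum>\<pi>\<in>S. if \<pi> = \<rho> then signof \<pi> else 0)"
    unfolding lookup_sum using m_eq by (intro sum.cong refl) (auto simp: lookup_single when_def)
  ultimately have "(signof \<rho> :: 'k) = 0" using assms(1,3) by simp
  then show False by (simp add: sign_def split: if_splits)
qed

lemma generic_det_nonzero: "generic_det n \<noteq> (0 :: (nat \<times> nat, 'k::comm_ring_1) mpoly)"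
  unfolding generic_det_expand
proof (rule perm_sum_nonzero)
  show "id \<in> {\<pi>. \<pi> permutes {0..<n}}" by (simp add: permutes_id)
  show "\<pi> = id" if "\<pi> \<in> {\<pi>. \<pi> permutes {0..<n}}" "\<And>i. i \<in> {0..<n} \<Longrightarrow> \<pi> i = id i" for \<pi>
  proof
    show "\<pi> i = id i" for i using that by (cases "i \<in> {0..<n}") (auto simp: permutes_def)
  qed
qed (auto simp: finite_permutations)

text \<open>Expansion along row 0. The cofactors must be shown to be nonzero, since a zero factor
  would have total degree 0; \<open>2 \<le> n\<close> makes their degree \<open>n - 1\<close>
  positive.\<close>

theorem generic_det_strength_upper_bound:
  assumes n: "2 \<le> n"
  shows "\<exists>g h. strength_decomposition ({0..<n} \<times> {0..<n}) (generic_det n :: (nat \<times> nat, 'k::comm_ring_1) mpoly) n g h"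
proof -
  let ?X = "{0..<n} \<times> {0..<n}"
  let ?S = "\<lambda>j. {\<pi>. \<pi> permutes {0..<n} \<and> \<pi> 0 = j}"
  \<comment> \<open>Grouping by the value at 0 and keeping the sign of the whole permutation builds
    the sign of the cofactor into \<open>h j\<close>.\<close>
  define h :: "nat \<Rightarrow> (nat \<times> nat, 'k) mpoly"
    where "h j = (\<Sum>\<pi>\<in>?S j. signof \<pi> * (\<Prod>i = 1..<n. var (i, \<pi> i)))" for j
  have fin: "finite {\<pi>. \<pi> permutes {0..<n}}" by (simp add: finite_permutations)
  then have fin_j: "finite (?S j)" for j by (rule finite_subset[rotated]) auto
  have h_forms: "h j \<in> forms ?X (n - 1)" for j
  proof -
    have "(\<Prod>i = 1..<n. var (i, \<pi> i) :: (nat \<times> nat, 'k) mpoly) \<in> forms ?X (\<Sum>i = 1..<n. 1)"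
      if "\<pi> permutes {0..<n}" for \<pi>
      using that by (intro forms_prod forms_var) (auto simp: permutes_nat_less)
    then show ?thesis unfolding h_def by (intro forms_sum forms_sign_mult) auto
  qed
  have h_nz: "h j \<noteq> 0" if "j < n" for j
    unfolding h_def
  proof (rule perm_sum_nonzero[OF fin_j])
    \<comment> \<open>The transposition serves as the permutation with a monomial of its own; a
      permutation is determined by its values off 0 once its value at 0 is \<open>j\<close>.\<close>
    show "transpose 0 j \<in> ?S j" using that by (auto intro!: permutes_swap_id)
    fix \<pi> assume \<pi>: "\<pi> \<in> ?S j" and eq: "\<And>i. i \<in> {1..<n} \<Longrightarrow> \<pi> i = transpose 0 j i"
    have "transpose 0 j permutes {0..<n}" using that by (intro permutes_swap_id) auto
    show "\<pi> = transpose 0 j"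
    proof
      fix i
      consider "i = 0" | "i \<in> {1..<n}" | "i \<notin> {0..<n}" by fastforce
      then show "\<pi> i = transpose 0 j i"
      proof cases
        case 3
        then show ?thesis using \<pi> \<open>transpose 0 j permutes {0..<n}\<close> by (auto simp: permutes_def)
      qed (use \<pi> eq in auto)
    qed
  qed auto
  have split: "(\<Prod>i = 0..<n. f i) = f 0 * (\<Prod>i = 1..<n. f i)" for f :: "nat \<Rightarrow> (nat \<times> nat, 'k) mpoly"
    using n by (simp add: prod.atLeast_Suc_lessThan)
  have "generic_det n = (\<Sum>\<pi> | \<pi> permutes {0..<n}. var (0, \<pi> 0) * (signof \<pi> * (\<Prod>i = 1..<n. var (i, \<pi> i)) :: (nat \<times> nat, 'k) mpoly))"
    unfolding generic_det_expand split by (simp add: ac_simps)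
  also have "\<dots> = (\<Sum>j<n. \<Sum>\<pi> | \<pi> \<in> {\<pi>. \<pi> permutes {0..<n}} \<and> \<pi> 0 = j. var (0, \<pi> 0) * (signof \<pi> * (\<Prod>i = 1..<n. var (i, \<pi> i))))"
    using n by (intro sum.group[symmetric] fin) (auto simp: permutes_nat_less)
  also have "\<dots> = (\<Sum>j<n. var (0, j) * h j)"
    unfolding h_def sum_distrib_left by (intro sum.cong) auto
  finally have eq: "generic_det n = (\<Sum>j<n. var (0, j) * h j)" .
  have deg: "total_degree (generic_det n :: (nat \<times> nat, 'k) mpoly) = n"
    by (rule total_degree_forms[OF generic_det_forms generic_det_nonzero])
  have v_forms: "var (0, j) \<in> forms ?X 1" if "j < n" for j using that n by (intro forms_var) auto
  have v_nz: "var x \<noteq> (0 :: (nat \<times> nat, 'k) mpoly)" for x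
    by (metis keys_single keys_zero empty_not_insert var_def zero_neq_one)
  have "strength_decomposition ?X (generic_det n :: (nat \<times> nat, 'k) mpoly) n (\<lambda>j. var (0, j)) h"
    unfolding strength_decomposition_def deg
  proof (intro conjI allI impI eq)
    fix j assume j: "j < n"
    have dv: "total_degree (var (0, j) :: (nat \<times> nat, 'k) mpoly) = 1" by (rule total_degree_forms[OF v_forms[OF j] v_nz])
    have dh: "total_degree (h j) = n - 1" by (rule total_degree_forms[OF h_forms h_nz[OF j]])
    show "var (0, j) \<in> polys_in ?X" by (rule subsetD[OF forms_subset_polys_in v_forms[OF j]])
    show "h j \<in> polys_in ?X" by (rule subsetD[OF forms_subset_polys_in h_forms])
    show "homogeneous (var (0, j) :: (nat \<times> nat, 'k) mpoly)" by (rule homogeneous_forms[OF v_forms[OF j]])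
    show "homogeneous (h j)" by (rule homogeneous_forms[OF h_forms])
    show "0 < total_degree (var (0, j) :: (nat \<times> nat, 'k) mpoly)"
      "total_degree (var (0, j) :: (nat \<times> nat, 'k) mpoly) < n"
      "0 < total_degree (h j)" "total_degree (h j) < n"
      using n by (simp_all add: dv dh)
  qed
  then show ?thesis by blast
qed

theorem theorem4p2:
  fixes p :: nat
  assumes "prime p"
  shows "strength ({0..<p} \<times> {0..<p})
           (generic_det p :: (nat \<times> nat, 'k::alg_closed_field) mpoly) = p"
  unfolding strength_def
proof (rule Least_equality)
  show "\<exists>g h. strength_decomposition ({0..<p} \<times> {0..<p}) (generic_det p :: (nat \<times> nat, 'k) mpoly) p g h"
    using generic_det_strength_upper_bound prime_ge_2_nat[OF assms] by blast
  show "p \<le> r"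
    if "\<exists>g h. strength_decomposition ({0..<p} \<times> {0..<p}) (generic_det p :: (nat \<times> nat, 'k) mpoly) r g h" for r
    using that generic_det_strength_lower_bound[OF assms] by blast
qed

end
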